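(* For every $n\in\mathbb{N}$ there is a constant $C(n)$ depending only on $n$ such that for every isotropic log-concave probability measure $\mu$ on $\mathbb{R}^n$ with density $\rho$ and isotropic constant $1$, and every vector $h\in\mathbb{R}^n$ with $|h|=1$, one has $\|D_h\mu\|_{\rm TV}\le C(n)$.
   Context: A log-concave probability measure on $\mathbb{R}^n$ is one with density $e^{-V}$ w.r.t. Lebesgue measure on an affine subspace, $V$ convex with values in $(-\infty,+\infty]$. It is isotropic if it is absolutely continuous w.r.t. Lebesgue measure on $\mathbb{R}^n$ and $\int(x,\theta)\mu(dx)=0$, $\int(x,\theta)^2\mu(dx)=L_\mu^2|\theta|^2$ for all $\theta\in\mathbb{R}^n$; $L_\mu$ is the isotropic constant. The Skorohod derivative $D_h\mu$ is the bounded signed Borel measure with $\int\partial_h\varphi\,d\mu=-\int\varphi\,d(D_h\mu)$ for all $\varphi\in C_b^\infty(\mathbb{R}^n)$; $\|D_h\mu\|_{\rm TV}$ is its total variation norm. *)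

theory Defs
  imports "HOL-Probability.Probability"
begin

definition convex_ereal_fun :: "('a::real_vector \<Rightarrow> ereal) \<Rightarrow> bool" where
  "convex_ereal_fun V \<longleftrightarrow>
     (\<forall>x y t. 0 < t \<and> t < 1 \<longrightarrow>
        V ((1 - t) *\<^sub>R x + t *\<^sub>R y) \<le> ereal (1 - t) * V x + ereal t * V y)"

definition log_concave_density :: "('a::euclidean_space \<Rightarrow> real) \<Rightarrow> bool" where
  "log_concave_density \<rho> \<longleftrightarrow>
     (\<exists>V :: 'a \<Rightarrow> ereal. (\<forall>x. V x \<noteq> -\<infinity>) \<and> convex_ereal_fun V \<and>
        (\<forall>x. \<rho> x = (if V x = \<infinity> then 0 else exp (- real_of_ereal (V x)))))"

definition isotropic_with_constant :: "'a::euclidean_space measure \<Rightarrow> real \<Rightarrow> bool" where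
  "isotropic_with_constant \<mu> L \<longleftrightarrow>
     prob_space \<mu> \<and> sets \<mu> = sets borel \<and> absolutely_continuous lborel \<mu> \<and>
     (\<forall>\<theta>. integrable \<mu> (\<lambda>x. x \<bullet> \<theta>) \<and> (\<integral>x. x \<bullet> \<theta> \<partial>\<mu>) = 0) \<and>
     (\<forall>\<theta>. integrable \<mu> (\<lambda>x. (x \<bullet> \<theta>)\<^sup>2) \<and> (\<integral>x. (x \<bullet> \<theta>)\<^sup>2 \<partial>\<mu>) = L\<^sup>2 * (norm \<theta>)\<^sup>2)"

fun iter_dderiv :: "('a::real_normed_vector \<Rightarrow> real) \<Rightarrow> 'a list \<Rightarrow> 'a \<Rightarrow> real" where
  "iter_dderiv \<phi> [] = \<phi>"
| "iter_dderiv \<phi> (v # vs) = (\<lambda>x. frechet_derivative (iter_dderiv \<phi> vs) (at x) v)"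

definition Cb_inf :: "('a::real_normed_vector \<Rightarrow> real) set" where
  "Cb_inf = {\<phi>. \<forall>vs. (\<forall>x. iter_dderiv \<phi> vs differentiable (at x)) \<and>
                      bounded (range (iter_dderiv \<phi> vs))}"

definition signed_borel_measure :: "('a::topological_space set \<Rightarrow> real) \<Rightarrow> bool" where
  "signed_borel_measure \<nu> \<longleftrightarrow>
     (\<forall>A. range A \<subseteq> sets borel \<longrightarrow> disjoint_family A \<longrightarrow> (\<lambda>i. \<nu> (A i)) sums \<nu> (\<Union>i. A i))"

definition pos_var :: "('a::topological_space set \<Rightarrow> real) \<Rightarrow> 'a measure" where
  "pos_var \<nu> = measure_of UNIV (sets borel)
     (\<lambda>A. ennreal (Sup {\<nu> B | B. B \<in> sets borel \<and> B \<subseteq> A}))"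

definition neg_var :: "('a::topological_space set \<Rightarrow> real) \<Rightarrow> 'a measure" where
  "neg_var \<nu> = measure_of UNIV (sets borel)
     (\<lambda>A. ennreal (Sup {- \<nu> B | B. B \<in> sets borel \<and> B \<subseteq> A}))"

definition signed_integral :: "('a::topological_space set \<Rightarrow> real) \<Rightarrow> ('a \<Rightarrow> real) \<Rightarrow> real" where
  "signed_integral \<nu> \<phi> = (\<integral>x. \<phi> x \<partial>pos_var \<nu>) - (\<integral>x. \<phi> x \<partial>neg_var \<nu>)"

definition tv_norm :: "('a::topological_space set \<Rightarrow> real) \<Rightarrow> real" where
  "tv_norm \<nu> = Sup {(\<Sum>A\<in>\<A>. \<bar>\<nu> A\<bar>) | \<A>. finite \<A> \<and> \<A> \<subseteq> sets borel \<and> disjoint \<A>}"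

definition skorohod_derivative :: "'a::euclidean_space measure \<Rightarrow> 'a \<Rightarrow> ('a set \<Rightarrow> real) \<Rightarrow> bool" where
  "skorohod_derivative \<mu> h \<nu> \<longleftrightarrow> signed_borel_measure \<nu> \<and>
     (\<forall>\<phi>\<in>Cb_inf. (\<integral>x. frechet_derivative \<phi> (at x) h \<partial>\<mu>) = - signed_integral \<nu> \<phi>)"

end

theory Submission
  imports Defs
begin

text \<open>
  By the layer cake formula \<open>\<rho>\<close> is an integral of indicators of the convex sets \<open>{\<rho> > r}\<close>. On a line
  parallel to \<open>h\<close> such an indicator is that of an interval, whose derivative is the difference of the
  unit masses at its two endpoints. Hence \<open>D\<^sub>h \<mu>\<close> is the difference of two positive measures, each
  of total mass equal to the integral over the hyperplane orthogonal to \<open>h\<close> of the maxima of \<open>\<rho>\<close>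
  along the lines parallel to \<open>h\<close>.

  To bound this integral, let \<open>x0\<close> be a point with \<open>\<rho> \<le> 2 \<rho> x0\<close>. Isotropy forces a level set
  \<open>{\<rho> \<ge> \<epsilon> \<rho> x0}\<close>, with \<open>\<epsilon>\<close> depending only on the dimension, to contain a segment \<open>[p, p + h/4]\<close>.
  By midpoint log-concavity \<open>\<rho> ((y + z) / 2) \<ge> (\<epsilon> / 2) \<rho> y\<close> for all \<open>y\<close> and all \<open>z\<close> in this segment,
  so that the value of \<open>\<rho>\<close> at any point of a line is bounded by the integral of
  \<open>\<lambda>x. \<rho> ((x + p) / 2)\<close> over that line. Integrating over all lines gives a bound that depends only
  on the dimension.
\<close>

subsection \<open>Differences of finite measures\<close>

text \<open>The terms of a convergent series tend to zero, so the constant family of empty sets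
  forces \<open>\<nu> {} = 0\<close>. Countable additivity then applies to \<open>A\<close> and
  \<open>B\<close> padded by empty sets.\<close>

lemma signed_borel_measure_Un:
  assumes \<nu>: "signed_borel_measure \<nu>" and AB: "A \<in> sets borel" "B \<in> sets borel" "A \<inter> B = {}"
  shows "\<nu> (A \<union> B) = \<nu> A + \<nu> B"
proof -
  have e: "\<nu> {} = 0"
  proof -
    have "(\<lambda>i::nat. \<nu> {}) sums \<nu> (\<Union>i::nat. {})"
      using \<nu> unfolding signed_borel_measure_def
      by (auto simp: disjoint_family_on_def dest!: spec[where x="\<lambda>_. {}"])
    then have "(\<lambda>i::nat. \<nu> {}) \<longlonglongrightarrow> 0"
      by (intro summable_LIMSEQ_zero) (auto simp: sums_iff)
    then show ?thesis by (simp add: LIMSEQ_const_iff)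
  qed
  define F where "F = (\<lambda>i::nat. if i = 0 then A else if i = 1 then B else {})"
  have "(\<lambda>i. \<nu> (F i)) sums \<nu> (\<Union>i. F i)"
  proof -
    have "range F \<subseteq> sets borel" "disjoint_family F"
      using AB by (auto simp: disjoint_family_on_def F_def)
    then show ?thesis using \<nu> unfolding signed_borel_measure_def by blast
  qed
  moreover have "(\<Union>i. F i) = A \<union> B"
    by (auto simp: F_def split: if_splits)
  moreover have "(\<lambda>i. \<nu> (F i)) sums (\<Sum>i\<in>{0,1}. \<nu> (F i))"
    by (rule sums_finite) (auto simp: F_def e)
  ultimately show ?thesis
    by (simp add: F_def sums_iff)
qed

lemma sets_pos_var [simp]: "sets (pos_var \<nu>) = sets borel"
  using sets.sets_measure_of_eq[of borel] by (simp add: pos_var_def)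

text \<open>For a Hahn positive set \<open>Y\<close> the supremum defining \<open>pos_var\<close> is
  attained at \<open>A \<inter> Y\<close>. This makes it countably additive, so that
  \<open>measure_of\<close> really carries this set function and not the zero measure it falls back
  on otherwise.\<close>

lemma emeasure_pos_var:
  fixes \<nu> :: "'a::topological_space set \<Rightarrow> real"
  assumes \<nu>: "signed_borel_measure \<nu>" and Y: "Y \<in> sets borel"
    and pos: "\<And>X. X \<in> sets borel \<Longrightarrow> X \<subseteq> Y \<Longrightarrow> 0 \<le> \<nu> X"
    and neg: "\<And>X. X \<in> sets borel \<Longrightarrow> X \<inter> Y = {} \<Longrightarrow> \<nu> X \<le> 0"
    and A: "A \<in> sets borel"
  shows "emeasure (pos_var \<nu>) A = ennreal (\<nu> (A \<inter> Y))"
proof -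
  have un: "\<nu> X = \<nu> (X \<inter> Z) + \<nu> (X - Z)" if "X \<in> sets borel" "Z \<in> sets borel" for X Z
  proof -
    have "\<nu> (X \<inter> Z \<union> (X - Z)) = \<nu> (X \<inter> Z) + \<nu> (X - Z)"
      by (rule signed_borel_measure_Un[OF \<nu>]) (use that in auto)
    then show ?thesis by (simp add: Int_Diff_Un)
  qed
  have sup: "Sup {\<nu> B | B. B \<in> sets borel \<and> B \<subseteq> A} = \<nu> (A \<inter> Y)" if A: "A \<in> sets borel" for A
  proof (rule cSup_eq_maximum)
    show "\<nu> (A \<inter> Y) \<in> {\<nu> B | B. B \<in> sets borel \<and> B \<subseteq> A}" using A Y by auto
  next
    fix z assume "z \<in> {\<nu> B | B. B \<in> sets borel \<and> B \<subseteq> A}"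
    then obtain B where B: "z = \<nu> B" "B \<in> sets borel" "B \<subseteq> A" by auto
    have "\<nu> B = \<nu> (B \<inter> Y) + \<nu> (B - Y)" by (rule un) (use B Y in auto)
    also have "\<nu> (B - Y) \<le> 0" using neg[of "B - Y"] B Y by auto
    also have "\<nu> (B \<inter> Y) + 0 \<le> \<nu> (A \<inter> Y)"
    proof -
      have "\<nu> (A \<inter> Y) = \<nu> (A \<inter> Y \<inter> B) + \<nu> (A \<inter> Y - B)" by (rule un) (use A B Y in auto)
      moreover have "A \<inter> Y \<inter> B = B \<inter> Y" using B by blast
      moreover have "0 \<le> \<nu> (A \<inter> Y - B)" using pos[of "A \<inter> Y - B"] A B Y by auto
      ultimately show ?thesis by simp
    qed
    finally show "z \<le> \<nu> (A \<inter> Y)" using B by simp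
  qed
  let ?f = "\<lambda>A. ennreal (Sup {\<nu> B | B. B \<in> sets borel \<and> B \<subseteq> A})"
  have "emeasure (pos_var \<nu>) A = ?f A"
  proof (rule emeasure_measure_of[OF pos_var_def])
    show "positive (sets (pos_var \<nu>)) ?f"
      using un[of "{}" "{}"] sup[of "{}"] by (auto simp: positive_def)
    show "countably_additive (sets (pos_var \<nu>)) ?f"
      unfolding sets_pos_var
    proof (rule countably_additiveI)
      fix F :: "nat \<Rightarrow> 'a set" assume F: "range F \<subseteq> sets borel" "disjoint_family F"
        "\<Union> (range F) \<in> sets borel"
      have "(\<lambda>i. \<nu> (F i \<inter> Y)) sums \<nu> (\<Union>i. F i \<inter> Y)"
      proof -
        have "range (\<lambda>i. F i \<inter> Y) \<subseteq> sets borel" "disjoint_family (\<lambda>i. F i \<inter> Y)"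
          using F Y by (auto simp: disjoint_family_on_def)
        then show ?thesis using \<nu> unfolding signed_borel_measure_def by blast
      qed
      moreover have "0 \<le> \<nu> (F i \<inter> Y)" for i using pos[of "F i \<inter> Y"] F Y by auto
      ultimately have "(\<Sum>i. ennreal (\<nu> (F i \<inter> Y))) = ennreal (\<nu> (\<Union>i. F i \<inter> Y))"
        by (intro suminf_ennreal_eq) auto
      moreover have "?f (F i) = ennreal (\<nu> (F i \<inter> Y))" for i
        using sup[of "F i"] F by auto
      moreover have "?f (\<Union> (range F)) = ennreal (\<nu> (\<Union>i. F i \<inter> Y))"
        using sup[OF F(3)] by simp
      ultimately show "(\<Sum>i. ?f (F i)) = ?f (\<Union> (range F))" by presburger
    qed
    show "A \<in> sets (pos_var \<nu>)" using A by simp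
  qed auto
  then show ?thesis using sup[OF A] by simp
qed

lemma neg_var_eq_pos_var: "neg_var \<nu> = pos_var (\<lambda>A. - \<nu> A)"
  unfolding neg_var_def pos_var_def by simp

text \<open>An equality of differences of measures is kept in additive form, which avoids
  subtraction in \<open>ennreal\<close>. It passes from sets to functions by induction over
  nonnegative measurable functions, with monotone convergence for the limits.\<close>

lemma nn_integral_add_eq_add:
  fixes f :: "'a \<Rightarrow> ennreal"
  assumes f: "f \<in> borel_measurable M"
    and sets: "sets N1 = sets M" "sets N2 = sets M" "sets N3 = sets M"
    and eq: "\<And>A. A \<in> sets M \<Longrightarrow> emeasure M A + emeasure N1 A = emeasure N2 A + emeasure N3 A"
  shows "(\<integral>\<^sup>+x. f x \<partial>M) + (\<integral>\<^sup>+x. f x \<partial>N1) = (\<integral>\<^sup>+x. f x \<partial>N2) + (\<integral>\<^sup>+x. f x \<partial>N3)"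
proof -
  note meas = measurable_cong_sets[OF sets(1) refl] measurable_cong_sets[OF sets(2) refl]
    measurable_cong_sets[OF sets(3) refl]
  note sp = sets_eq_imp_space_eq[OF sets(1)] sets_eq_imp_space_eq[OF sets(2)] sets_eq_imp_space_eq[OF sets(3)]
  from f show ?thesis
  proof induction
    case (cong f g)
    have "integral\<^sup>N L f = integral\<^sup>N L g" if "space L = space M" for L
      using cong that by (intro nn_integral_cong) auto
    with cong sp show ?case by simp
  next
    case (set A)
    then show ?case using eq sets by simp
  next
    case (mult u c)
    then show ?case by (simp add: nn_integral_cmult meas distrib_left[symmetric])
  next
    case (add u v)
    have *: "(b + a) + (d + c) = (b' + a') + (d' + c')"
      if "a + c = a' + c'" "b + d = b' + d'" for a b c d a' b' c' d' :: ennreal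
    proof -
      have "(b + a) + (d + c) = (a + c) + (b + d)" by (simp add: ac_simps)
      also have "\<dots> = (b' + a') + (d' + c')" unfolding that by (simp add: ac_simps)
      finally show ?thesis .
    qed
    from add show ?case
      by (simp add: nn_integral_add meas) (rule *; assumption)
  next
    case (seq U)
    have *: "(\<integral>\<^sup>+x. (SUP i. U i) x \<partial>L) = (SUP i. \<integral>\<^sup>+x. U i x \<partial>L)" if "sets L = sets M" for L
      using seq that by (subst nn_integral_monotone_convergence_SUP[symmetric])
        (auto simp: measurable_cong_sets[OF that refl] SUP_apply image_comp intro!: nn_integral_cong)
    have inc: "incseq (\<lambda>i. \<integral>\<^sup>+x. U i x \<partial>L)" for L
      using seq by (auto simp: incseq_def le_fun_def intro!: nn_integral_mono)
    show ?case
      unfolding *[OF refl] *[OF sets(1)] *[OF sets(2)] *[OF sets(3)] ennreal_SUP_add[OF inc inc, symmetric] seq ..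
  qed
qed

text \<open>The variations P and Q of \<open>\<nu>\<close> come from a Hahn decomposition of
  \<open>N1\<close> against \<open>N2\<close>. They may be smaller than \<open>N1\<close> and
  \<open>N2\<close>, but P + N2 = Q + N1, which determines the integrals of bounded functions. For
  the norm, \<open>\<bar>N1 A - N2 A\<bar> \<le> N1 A + N2 A\<close> is summed over disjoint
  sets.\<close>

lemma
  fixes N1 N2 :: "'a::topological_space measure"
  assumes fin: "finite_measure N1" "finite_measure N2"
    and sets: "sets N1 = sets borel" "sets N2 = sets borel"
  defines "\<nu> \<equiv> \<lambda>A. measure N1 A - measure N2 A"
  shows signed_borel_measure_diff: "signed_borel_measure \<nu>"
    and tv_norm_diff_le: "tv_norm \<nu> \<le> measure N1 UNIV + measure N2 UNIV"
    and signed_integral_diff: "\<And>\<phi>. \<phi> \<in> borel_measurable borel \<Longrightarrow> bounded (range \<phi>) \<Longrightarrow>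
        signed_integral \<nu> \<phi> = (\<integral>x. \<phi> x \<partial>N1) - (\<integral>x. \<phi> x \<partial>N2)"
proof -
  interpret N1: finite_measure N1 by fact
  interpret N2: finite_measure N2 by fact
  have space: "space N1 = UNIV" "space N2 = UNIV"
    using sets_eq_imp_space_eq[OF sets(1)] sets_eq_imp_space_eq[OF sets(2)] by simp_all
  show s: "signed_borel_measure \<nu>"
    unfolding signed_borel_measure_def \<nu>_def
  proof (intro allI impI)
    fix F :: "nat \<Rightarrow> 'a set" assume "range F \<subseteq> sets borel" "disjoint_family F"
    then show "(\<lambda>i. measure N1 (F i) - measure N2 (F i)) sums (measure N1 (\<Union> (range F)) - measure N2 (\<Union> (range F)))"
      by (intro sums_diff N1.finite_measure_UNION N2.finite_measure_UNION) (simp_all add: sets)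
  qed
  have s': "signed_borel_measure (\<lambda>A. - \<nu> A)"
    using s unfolding signed_borel_measure_def by (metis sums_minus)
  show "tv_norm \<nu> \<le> measure N1 UNIV + measure N2 UNIV"
    unfolding tv_norm_def
  proof (rule cSup_least)
    have "finite ({}::'a set set) \<and> {} \<subseteq> sets (borel::'a measure) \<and> disjoint ({}::'a set set)" by simp
    then show "{\<Sum>A\<in>\<A>. \<bar>\<nu> A\<bar> |\<A>. finite \<A> \<and> \<A> \<subseteq> sets borel \<and> disjoint \<A>} \<noteq> {}" by blast
  next
    fix z assume "z \<in> {\<Sum>A\<in>\<A>. \<bar>\<nu> A\<bar> |\<A>. finite \<A> \<and> \<A> \<subseteq> sets borel \<and> disjoint \<A>}"
    then obtain \<A> where \<A>: "finite \<A>" "\<A> \<subseteq> sets borel" "disjoint \<A>" and z: "z = (\<Sum>A\<in>\<A>. \<bar>\<nu> A\<bar>)" by auto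
    have d: "disjoint_family_on id \<A>" using \<A>(3) by (auto simp: disjoint_family_on_def disjoint_def)
    have "(\<Sum>A\<in>\<A>. \<bar>\<nu> A\<bar>) \<le> (\<Sum>A\<in>\<A>. measure N1 A + measure N2 A)"
      by (intro sum_mono) (auto simp: \<nu>_def abs_if)
    also have "\<dots> = measure N1 (\<Union>\<A>) + measure N2 (\<Union>\<A>)"
      using N1.finite_measure_finite_Union[OF \<A>(1) _ d] N2.finite_measure_finite_Union[OF \<A>(1) _ d] \<A>(2)
      by (simp add: sets sum.distrib)
    also have "\<dots> \<le> measure N1 UNIV + measure N2 UNIV"
      using N1.bounded_measure N2.bounded_measure space by (intro add_mono) auto
    finally show "z \<le> measure N1 UNIV + measure N2 UNIV" using z by simp
  qed
  obtain Y where Y: "Y \<in> sets borel"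
    and Y1: "\<And>X. X \<in> sets borel \<Longrightarrow> X \<subseteq> Y \<Longrightarrow> emeasure N2 X \<le> emeasure N1 X"
    and Y2: "\<And>X. X \<in> sets borel \<Longrightarrow> X \<inter> Y = {} \<Longrightarrow> emeasure N1 X \<le> emeasure N2 X"
    using finite_unsigned_Hahn_decomposition[OF fin] sets by metis
  have pos: "0 \<le> \<nu> X" if "X \<in> sets borel" "X \<subseteq> Y" for X
    using Y1[OF that] by (simp add: \<nu>_def N1.emeasure_eq_measure N2.emeasure_eq_measure)
  have neg: "\<nu> X \<le> 0" if "X \<in> sets borel" "X \<inter> Y = {}" for X
    using Y2[OF that] by (simp add: \<nu>_def N1.emeasure_eq_measure N2.emeasure_eq_measure)
  let ?P = "pos_var \<nu>" and ?Q = "neg_var \<nu>"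
  have P: "emeasure ?P A = ennreal (\<nu> (A \<inter> Y))" if "A \<in> sets borel" for A
    using emeasure_pos_var[OF s Y pos neg that] .
  have Q: "emeasure ?Q A = ennreal (- \<nu> (A - Y))" if "A \<in> sets borel" for A
    unfolding neg_var_eq_pos_var Diff_eq
    by (rule emeasure_pos_var[OF s']) (use Y that in \<open>auto intro!: pos neg\<close>)
  have sQ: "sets ?Q = sets borel" by (simp add: neg_var_eq_pos_var)
  have add: "emeasure ?P A + emeasure N2 A = emeasure ?Q A + emeasure N1 A" if "A \<in> sets ?P" for A
  proof -
    have A: "A \<in> sets borel" using that by simp
    have "\<nu> (A \<inter> Y \<union> (A - Y)) = \<nu> (A \<inter> Y) + \<nu> (A - Y)"
      by (rule signed_borel_measure_Un[OF s]) (use A Y in auto)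
    then have "\<nu> A = \<nu> (A \<inter> Y) + \<nu> (A - Y)" by (simp add: Int_Diff_Un)
    moreover have "0 \<le> \<nu> (A \<inter> Y)" "\<nu> (A - Y) \<le> 0" using pos[of "A \<inter> Y"] neg[of "A - Y"] A Y by auto
    ultimately have "\<nu> (A \<inter> Y) + measure N2 A = - \<nu> (A - Y) + measure N1 A"
      "0 \<le> \<nu> (A \<inter> Y)" "0 \<le> - \<nu> (A - Y)"
      unfolding \<nu>_def by linarith+
    then show ?thesis
      unfolding P[OF A] Q[OF A] N1.emeasure_eq_measure N2.emeasure_eq_measure
      by (simp flip: ennreal_plus)
  qed
  fix \<phi> :: "'a \<Rightarrow> real" assume \<phi>[measurable]: "\<phi> \<in> borel_measurable borel" and "bounded (range \<phi>)"
  then obtain B where B: "\<And>x. \<bar>\<phi> x\<bar> \<le> B" by (auto simp: bounded_iff)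
  have B0: "0 \<le> B" using B[of undefined] by simp
  \<comment> \<open>Adding the bound \<open>B\<close> makes the integrand nonnegative, so that the
    additive identity applies. The extra masses cancel afterwards by the same identity evaluated at
    \<open>UNIV\<close>.\<close>
  have key: "integrable L \<phi>" "(\<integral>\<^sup>+x. ennreal (\<phi> x + B) \<partial>L) = ennreal ((\<integral>x. \<phi> x \<partial>L) + B * measure L UNIV)"
      "emeasure L UNIV = ennreal (measure L UNIV)" "0 \<le> (\<integral>x. \<phi> x \<partial>L) + B * measure L UNIV"
    if L: "sets L = sets borel" "emeasure L UNIV \<noteq> \<infinity>" for L :: "'a measure"
  proof -
    have sp: "space L = UNIV" using sets_eq_imp_space_eq[OF L(1)] by simp
    interpret finite_measure L by (rule finite_measureI) (use L sp in simp)
    show i: "integrable L \<phi>"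
      by (rule integrable_const_bound[of _ B]) (use B L in \<open>auto simp: measurable_cong_sets[OF L(1) refl]\<close>)
    then have i': "integrable L (\<lambda>x. \<phi> x + B)" by simp
    have nn: "0 \<le> \<phi> x + B" for x using B[of x] by (simp add: abs_if split: if_splits)
    have e: "(\<integral>x. \<phi> x + B \<partial>L) = (\<integral>x. \<phi> x \<partial>L) + B * measure L UNIV"
      using i by (simp add: sp)
    show "(\<integral>\<^sup>+x. ennreal (\<phi> x + B) \<partial>L) = ennreal ((\<integral>x. \<phi> x \<partial>L) + B * measure L UNIV)"
      using nn_integral_eq_integral[OF i'] nn e by simp
    show "emeasure L UNIV = ennreal (measure L UNIV)" by (rule emeasure_eq_measure)
    show "0 \<le> (\<integral>x. \<phi> x \<partial>L) + B * measure L UNIV" using Bochner_Integration.integral_nonneg[of L "\<lambda>x. \<phi> x + B"] nn e by simp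
  qed
  have fin': "emeasure ?P UNIV \<noteq> \<infinity>" "emeasure ?Q UNIV \<noteq> \<infinity>" "emeasure N1 UNIV \<noteq> \<infinity>" "emeasure N2 UNIV \<noteq> \<infinity>"
    using P Q N1.emeasure_eq_measure N2.emeasure_eq_measure by auto
  note kP = key[OF sets_pos_var fin'(1)] and kQ = key[OF sQ fin'(2)]
    and k1 = key[OF sets(1) fin'(3)] and k2 = key[OF sets(2) fin'(4)]
  have "(\<integral>\<^sup>+x. ennreal (\<phi> x + B) \<partial>?P) + (\<integral>\<^sup>+x. ennreal (\<phi> x + B) \<partial>N2)
      = (\<integral>\<^sup>+x. ennreal (\<phi> x + B) \<partial>?Q) + (\<integral>\<^sup>+x. ennreal (\<phi> x + B) \<partial>N1)"
    by (rule nn_integral_add_eq_add) (auto simp: sets sQ add measurable_cong_sets[OF sets_pos_var refl])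
  then have 1: "(\<integral>x. \<phi> x \<partial>?P) + B * measure ?P UNIV + ((\<integral>x. \<phi> x \<partial>N2) + B * measure N2 UNIV)
      = (\<integral>x. \<phi> x \<partial>?Q) + B * measure ?Q UNIV + ((\<integral>x. \<phi> x \<partial>N1) + B * measure N1 UNIV)"
    unfolding kP kQ k1 k2 using kP(4) kQ(4) k1(4) k2(4)
    by (simp flip: ennreal_plus)
  have "measure ?P UNIV + measure N2 UNIV = measure ?Q UNIV + measure N1 UNIV"
    using add[of UNIV] unfolding kP(3) kQ(3) k1(3) k2(3) by (simp flip: ennreal_plus)
  then have "B * measure ?P UNIV + B * measure N2 UNIV = B * measure ?Q UNIV + B * measure N1 UNIV"
    by (simp flip: distrib_left)
  with 1 show "signed_integral \<nu> \<phi> = (\<integral>x. \<phi> x \<partial>N1) - (\<integral>x. \<phi> x \<partial>N2)"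
    unfolding signed_integral_def by linarith
qed

subsection \<open>Integration along parallel lines\<close>

text \<open>A line in the unit direction \<open>h\<close> meets the slab in a segment of length one, so that Lebesgue measure
  on the slab can stand in for that on the hyperplane orthogonal to \<open>h\<close>.\<close>

definition slab :: "'a::euclidean_space \<Rightarrow> 'a set" where
  "slab h = {x. 0 \<le> x \<bullet> h \<and> x \<bullet> h < 1}"

lemma slab_borel [measurable]: "slab h \<in> sets borel"
  unfolding slab_def by measurable

text \<open>After Fubini and a translation by \<open>t *\<^sub>R h\<close>, the point
  \<open>x\<close> is fixed and the parameters \<open>t\<close> with
  \<open>x - t *\<^sub>R h\<close> in the slab form a half-open interval of length one, because
  \<open>h \<bullet> h = 1\<close>.\<close>

lemma nn_integral_slab_lines:
  fixes F :: "'a::euclidean_space \<Rightarrow> ennreal"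
  assumes h: "norm h = 1" and F[measurable]: "F \<in> borel_measurable borel"
  shows "(\<integral>\<^sup>+x. \<integral>\<^sup>+t. indicator (slab h) x * F (x + t *\<^sub>R h) \<partial>lborel \<partial>lborel) = (\<integral>\<^sup>+x. F x \<partial>lborel)"
proof -
  have "(\<integral>\<^sup>+x. \<integral>\<^sup>+t. indicator (slab h) x * F (x + t *\<^sub>R h) \<partial>lborel \<partial>lborel)
      = (\<integral>\<^sup>+t. \<integral>\<^sup>+x. indicator (slab h) x * F (x + t *\<^sub>R h) \<partial>lborel \<partial>lborel)"
    by (rule lborel_pair.Fubini'[symmetric]) measurable
  also have "\<dots> = (\<integral>\<^sup>+t. \<integral>\<^sup>+x. indicator (slab h) (x - t *\<^sub>R h) * F x \<partial>lborel \<partial>lborel)"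
  proof (rule nn_integral_cong)
    fix t :: real
    have "(\<integral>\<^sup>+x. indicator (slab h) (x - t *\<^sub>R h) * F x \<partial>lborel)
        = (\<integral>\<^sup>+x. indicator (slab h) (x - t *\<^sub>R h) * F x \<partial>distr lborel borel ((+) (t *\<^sub>R h)))"
      by (simp only: lborel_distr_plus)
    also have "\<dots> = (\<integral>\<^sup>+x. indicator (slab h) x * F (x + t *\<^sub>R h) \<partial>lborel)"
      by (subst nn_integral_distr) (auto simp: add.commute)
    finally show "(\<integral>\<^sup>+x. indicator (slab h) x * F (x + t *\<^sub>R h) \<partial>lborel)
        = (\<integral>\<^sup>+x. indicator (slab h) (x - t *\<^sub>R h) * F x \<partial>lborel)" by simp
  qed
  also have "\<dots> = (\<integral>\<^sup>+x. \<integral>\<^sup>+t. indicator (slab h) (x - t *\<^sub>R h) * F x \<partial>lborel \<partial>lborel)"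
    by (rule lborel_pair.Fubini') measurable
  also have "\<dots> = (\<integral>\<^sup>+x. F x \<partial>lborel)"
  proof (rule nn_integral_cong)
    fix x :: 'a
    have hh: "h \<bullet> h = 1" using h by (simp add: dot_square_norm)
    have "(\<integral>\<^sup>+t. indicator (slab h) (x - t *\<^sub>R h) * F x \<partial>lborel)
        = (\<integral>\<^sup>+t. indicator {x \<bullet> h - 1 <.. x \<bullet> h} t \<partial>lborel) * F x"
      by (subst nn_integral_multc[symmetric])
        (auto intro!: nn_integral_cong simp: slab_def inner_diff_left hh split: split_indicator)
    also have "\<dots> = F x" by simp
    finally show "(\<integral>\<^sup>+t. indicator (slab h) (x - t *\<^sub>R h) * F x \<partial>lborel) = F x" .
  qed
  finally show ?thesis .
qed

text \<open>Passing to rational points keeps the endpoints of a line section measurable in the section.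
  The price is that a section without rational points has no endpoints; it is Lebesgue null.\<close>

definition rat_inf :: "real set \<Rightarrow> ereal" where
  "rat_inf I = (INF q\<in>\<rat>. if q \<in> I then ereal q else \<infinity>)"

definition rat_sup :: "real set \<Rightarrow> ereal" where
  "rat_sup I = (SUP q\<in>\<rat>. if q \<in> I then ereal q else -\<infinity>)"

text \<open>Reflection at zero preserves the rationals, so facts about left endpoints carry over to
  right endpoints.\<close>

lemma rat_sup_eq_uminus: "rat_sup I = - rat_inf (uminus ` I)"
proof -
  have r: "uminus ` \<rat> = (\<rat> :: real set)"
    by (auto simp: image_iff intro!: bexI[where x="- _"])
  have "rat_inf (uminus ` I) = (INF q\<in>uminus ` \<rat>. if q \<in> uminus ` I then ereal q else \<infinity>)"
    by (simp add: rat_inf_def r)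
  also have "\<dots> = (INF q\<in>\<rat>. - (if q \<in> I then ereal q else -\<infinity>))"
    unfolding image_image by (intro INF_cong) (auto simp: image_iff)
  finally show ?thesis by (simp add: rat_sup_def ereal_INF_uminus_eq)
qed

text \<open>Read backwards: a finite \<open>rat_inf\<close> certifies that the set contains a
  rational point.\<close>

lemma rat_inf_no_rats:
  assumes "I \<inter> \<rat> = {}"
  shows "rat_inf I = \<infinity>"
proof -
  have "rat_inf I = (INF q\<in>(\<rat>::real set). top)"
    unfolding rat_inf_def using assms by (intro INF_cong) (auto simp: top_ereal_def)
  then show ?thesis by (simp flip: top_ereal_def)
qed

text \<open>One rational point \<open>q\<close> in \<open>I\<close> is enough for the rational
  points to see the true infimum: a point of \<open>I\<close> below \<open>Inf J\<close> would leave
  a rational strictly between, and by convexity this rational would lie in \<open>J\<close>.\<close>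

lemma rat_inf_interval:
  fixes I :: "real set"
  assumes I: "convex I" "bdd_below I" and q: "q \<in> I" "q \<in> \<rat>"
  obtains a where "rat_inf I = ereal a" "a \<le> q" "\<And>x. x \<in> I \<Longrightarrow> a \<le> x" "\<And>x. a < x \<Longrightarrow> x \<le> q \<Longrightarrow> x \<in> I"
proof -
  define J where "J = I \<inter> \<rat>"
  have J: "q \<in> J" "bdd_below J" using q I(2) by (auto simp: J_def)
  have bet: "y \<in> I" if "x \<in> I" "z \<in> I" "x \<le> y" "y \<le> z" for x y z
    using I(1) that by (meson is_interval_convex_1 mem_is_interval_1_I)
  have "rat_inf I = (INF q\<in>J. ereal q)"
  proof (rule antisym)
    show "rat_inf I \<le> (INF q\<in>J. ereal q)"
      unfolding rat_inf_def J_def by (intro INF_mono) force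
    show "(INF q\<in>J. ereal q) \<le> rat_inf I"
      unfolding rat_inf_def by (intro INF_greatest) (auto simp: J_def intro: INF_lower)
  qed
  also have "\<dots> = ereal (Inf J)" by (rule ereal_Inf'[symmetric]) (use J in auto)
  finally have 1: "rat_inf I = ereal (Inf J)" .
  have 2: "Inf J \<le> q" using J by (intro cInf_lower)
  have 3: "Inf J \<le> x" if x: "x \<in> I" for x
  proof (rule ccontr)
    assume "\<not> Inf J \<le> x"
    then obtain q' where q': "q' \<in> \<rat>" "x < q'" "q' < Inf J" using Rats_dense_in_real[of x "Inf J"] by auto
    then have "q' \<in> J" using bet[OF x q(1), of q'] 2 by (simp add: J_def)
    then have "Inf J \<le> q'" using J by (intro cInf_lower)
    with q' show False by simp
  qed
  have 4: "x \<in> I" if "Inf J < x" "x \<le> q" for x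
  proof -
    obtain y where "y \<in> J" "y < x" using cInf_lessD[of J x] J \<open>Inf J < x\<close> by auto
    then show ?thesis using bet[of y q x] q that by (auto simp: J_def)
  qed
  show thesis by (rule that[OF 1 2 3 4])
qed

lemma rat_sup_interval:
  fixes I :: "real set"
  assumes I: "convex I" "bdd_above I" and q: "q \<in> I" "q \<in> \<rat>"
  obtains b where "rat_sup I = ereal b" "q \<le> b" "\<And>x. x \<in> I \<Longrightarrow> x \<le> b" "\<And>x. q \<le> x \<Longrightarrow> x < b \<Longrightarrow> x \<in> I"
proof -
  have "convex (uminus ` I)" using convex_negations[OF I(1)] .
  moreover have "bdd_below (uminus ` I)" using I(2) by simp
  ultimately obtain a where a: "rat_inf (uminus ` I) = ereal a" "a \<le> - q"
      "\<And>x. x \<in> uminus ` I \<Longrightarrow> a \<le> x" "\<And>x. a < x \<Longrightarrow> x \<le> - q \<Longrightarrow> x \<in> uminus ` I"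
    using rat_inf_interval[of "uminus ` I" "- q"] q by auto
  show thesis
  proof (rule that[of "- a"])
    show "rat_sup I = ereal (- a)" by (simp add: rat_sup_eq_uminus a)
    show "q \<le> - a" using a(2) by simp
    show "x \<le> - a" if "x \<in> I" for x using a(3)[of "- x"] that by simp
    show "x \<in> I" if "q \<le> x" "x < - a" for x using a(4)[of "- x"] that by auto
  qed
qed

section \<open>The fundamental theorem of calculus on convex sets of reals\<close>

lemma convex_no_rats_subset_singleton:
  fixes I :: "real set"
  assumes I: "convex I" "I \<inter> \<rat> = {}"
  shows "\<exists>c. I \<subseteq> {c}"
proof -
  have F: False if xy: "x \<in> I" "y \<in> I" "x < y" for x y
  proof -
    obtain q where q: "q \<in> \<rat>" "x < q" "q < y" using Rats_dense_in_real[OF xy(3)] by auto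
    have "q \<in> I"
      using xy q I(1) mem_is_interval_1_I[of I x y q] by (simp add: is_interval_convex_1)
    with q(1) I(2) show False by auto
  qed
  have eq: "u = v" if "u \<in> I" "v \<in> I" for u v
    using F[OF that] F[OF that(2,1)] by (cases u v rule: linorder_cases) simp_all
  have "I \<subseteq> {SOME u. u \<in> I}"
  proof
    fix x assume x: "x \<in> I"
    then have "(SOME u. u \<in> I) \<in> I" by (rule someI)
    with x show "x \<in> {SOME u. u \<in> I}" using eq by simp
  qed
  then show ?thesis ..
qed

text \<open>Two points of \<open>I\<close> span an interval inside \<open>I\<close>, so their
  distance is at most the length \<open>M\<close> of \<open>I\<close>.\<close>

lemma convex_finite_measure_bounded:
  fixes I :: "real set"
  assumes I: "convex I" and fin: "emeasure lborel I < \<infinity>" and m: "I \<in> sets borel"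
  shows "bdd_above I" "bdd_below I"
proof -
  have bet: "y \<in> I" if "x \<in> I" "z \<in> I" "x \<le> y" "y \<le> z" for x y z
    using I that by (meson is_interval_convex_1 mem_is_interval_1_I)
  define M where "M = measure lborel I"
  have len: "z - x \<le> M" if "x \<in> I" "z \<in> I" "x \<le> z" for x z
  proof -
    have "emeasure lborel {x..z} \<le> emeasure lborel I"
    proof (rule emeasure_mono)
      show "{x..z} \<subseteq> I"
      proof
        fix y assume "y \<in> {x..z}"
        then show "y \<in> I" by (intro bet[OF that(1,2)]) simp_all
      qed
    qed (simp add: m)
    then show ?thesis using fin that
      by (simp add: M_def emeasure_eq_ennreal_measure top.not_eq_extremum)
  qed
  have M: "0 \<le> M" by (simp add: M_def)
  show "bdd_above I"
  proof (cases "I = {}")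
    case False
    then obtain x where "x \<in> I" by auto
    then have "z \<le> x + M" if "z \<in> I" for z
      using len[of x z] that M by (cases "x \<le> z") auto
    then show ?thesis by (auto simp: bdd_above_def)
  qed auto
  show "bdd_below I"
  proof (cases "I = {}")
    case False
    then obtain z where "z \<in> I" by auto
    then have "z - M \<le> x" if "x \<in> I" for x
      using len[of x z] that M by (cases "x \<le> z") auto
    then show ?thesis by (auto simp: bdd_below_def)
  qed auto
qed

text \<open>Finite length makes \<open>I\<close> bounded. With a rational point inside,
  \<open>I\<close> agrees up to its endpoints with a compact interval; without one it has at most
  one point and the integral vanishes.\<close>

lemma integral_indicator_convex_FTC:
  fixes f F :: "real \<Rightarrow> real"
  assumes I: "convex I" and fin: "emeasure lborel I < \<infinity>" and m: "I \<in> sets borel"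
    and deriv: "\<And>x. DERIV F x :> f x" and cont: "\<And>x. isCont f x"
  shows "(\<integral>x. indicator I x * f x \<partial>lborel) =
    (if \<bar>rat_inf I\<bar> \<noteq> \<infinity> \<and> \<bar>rat_sup I\<bar> \<noteq> \<infinity>
     then F (real_of_ereal (rat_sup I)) - F (real_of_ereal (rat_inf I)) else 0)"
proof -
  have [measurable]: "f \<in> borel_measurable borel"
    by (intro borel_measurable_continuous_onI continuous_at_imp_continuous_on) (auto simp: cont)
  show ?thesis
  proof (cases "I \<inter> \<rat> = {}")
    case True
    \<comment> \<open>The infinite value selects the else branch of the claim.\<close>
    then have "rat_inf I = \<infinity>" by (rule rat_inf_no_rats)
    moreover obtain c where c: "I \<subseteq> {c}" using convex_no_rats_subset_singleton[OF I True] ..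
    have "(\<integral>x. indicator I x * f x \<partial>lborel) = (\<integral>x. 0 \<partial>(lborel :: real measure))"
    proof (rule integral_cong_AE)
      show "AE x in lborel. indicator I x * f x = 0"
        using AE_lborel_singleton[of c] by eventually_elim (use c in \<open>auto split: split_indicator\<close>)
    qed (use m in measurable)
    ultimately show ?thesis by simp
  next
    case False
    then obtain q where q: "q \<in> I" "q \<in> \<rat>" by auto
    note bdd = convex_finite_measure_bounded[OF I fin m]
    obtain a where a: "rat_inf I = ereal a" "a \<le> q" "\<And>x. x \<in> I \<Longrightarrow> a \<le> x" "\<And>x. a < x \<Longrightarrow> x \<le> q \<Longrightarrow> x \<in> I"
      using rat_inf_interval[OF I bdd(2) q] by blast
    obtain b where b: "rat_sup I = ereal b" "q \<le> b" "\<And>x. x \<in> I \<Longrightarrow> x \<le> b" "\<And>x. q \<le> x \<Longrightarrow> x < b \<Longrightarrow> x \<in> I"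
      using rat_sup_interval[OF I bdd(1) q] by blast
    \<comment> \<open>Whether the endpoints belong to \<open>I\<close> stays open; two points do not
      affect the integral.\<close>
    have iff: "x \<in> I \<longleftrightarrow> x \<in> {a..b}" if "x \<noteq> a" "x \<noteq> b" for x
      using a(3,4)[of x] b(3,4)[of x] that by (cases "x \<le> q") auto
    have "(\<integral>x. indicator I x * f x \<partial>lborel) = (\<integral>x. f x * indicator {a..b} x \<partial>lborel)"
    proof (rule integral_cong_AE)
      show "AE x in lborel. indicator I x * f x = f x * indicator {a..b} x"
        using AE_lborel_singleton[of a] AE_lborel_singleton[of b]
        by eventually_elim (use iff in \<open>auto split: split_indicator\<close>)
    qed (use m in measurable)
    also have "\<dots> = F b - F a"
      using a(2) b(2) by (intro integral_FTC_Icc_real deriv cont) auto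
    finally show ?thesis by (simp add: a b)
  qed
qed

subsection \<open>Log-concave densities\<close>

lemma log_concave_density_nonneg: "log_concave_density \<rho> \<Longrightarrow> 0 \<le> \<rho> x"
  unfolding log_concave_density_def by auto

text \<open>Where \<open>\<rho>\<close> is positive the potential is finite, so convexity turns into
  an inequality between real numbers and the extended values of \<open>V\<close> disappear from
  later estimates.\<close>

lemma log_concave_densityE:
  assumes \<rho>: "log_concave_density \<rho>" and pos: "0 < \<rho> x" "0 < \<rho> y"
  obtains a b where "\<rho> x = exp (- a)" "\<rho> y = exp (- b)"
    "\<And>t. 0 < t \<Longrightarrow> t < 1 \<Longrightarrow> exp (- ((1 - t) * a + t * b)) \<le> \<rho> ((1 - t) *\<^sub>R x + t *\<^sub>R y)"
proof -
  obtain V where V: "\<And>x. V x \<noteq> -\<infinity>" "convex_ereal_fun V"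
      "\<And>x. \<rho> x = (if V x = \<infinity> then 0 else exp (- real_of_ereal (V x)))"
    using \<rho> unfolding log_concave_density_def by blast
  have "V x \<noteq> \<infinity>" "V y \<noteq> \<infinity>" using pos V(3) by (auto split: if_splits)
  then obtain a b where ab: "V x = ereal a" "V y = ereal b"
    using V(1) by (metis ereal_cases)
  show thesis
  proof (rule that[of a b])
    show "\<rho> x = exp (- a)" "\<rho> y = exp (- b)" using V(3) ab by auto
    fix t :: real assume t: "0 < t" "t < 1"
    let ?z = "(1 - t) *\<^sub>R x + t *\<^sub>R y"
    have le: "V ?z \<le> ereal ((1 - t) * a + t * b)"
      using V(2) t ab unfolding convex_ereal_fun_def by (metis plus_ereal.simps(1) times_ereal.simps(1))
    then obtain c where c: "V ?z = ereal c" using V(1)[of ?z] by (cases "V ?z") auto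
    with le have "c \<le> (1 - t) * a + t * b" by simp
    then show "exp (- ((1 - t) * a + t * b)) \<le> \<rho> ?z" using V(3)[of ?z] c by simp
  qed
qed

text \<open>Squaring avoids the roots of the usual geometric mean form, and the square on the right
  also covers the case of a vanishing factor.\<close>

lemma log_concave_density_midpoint:
  assumes \<rho>: "log_concave_density \<rho>"
  shows "\<rho> x * \<rho> y \<le> (\<rho> ((1/2) *\<^sub>R x + (1/2) *\<^sub>R y))\<^sup>2"
proof (cases "0 < \<rho> x \<and> 0 < \<rho> y")
  case True
  then obtain a b where ab: "\<rho> x = exp (- a)" "\<rho> y = exp (- b)"
    "\<And>t. 0 < t \<Longrightarrow> t < 1 \<Longrightarrow> exp (- ((1 - t) * a + t * b)) \<le> \<rho> ((1 - t) *\<^sub>R x + t *\<^sub>R y)"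
    using log_concave_densityE[OF \<rho>] by metis
  have "\<rho> x * \<rho> y = (exp (- ((1 - 1/2) * a + (1/2) * b)))\<^sup>2"
    unfolding ab power2_eq_square by (simp flip: exp_add add: field_simps)
  also have "\<dots> \<le> (\<rho> ((1/2) *\<^sub>R x + (1/2) *\<^sub>R y))\<^sup>2"
    using ab(3)[of "1/2"] by (intro power_mono) auto
  finally show ?thesis .
next
  case False
  then have "\<rho> x * \<rho> y \<le> 0"
    using log_concave_density_nonneg[OF \<rho>, of x] log_concave_density_nonneg[OF \<rho>, of y]
    by (auto simp: not_less mult_nonneg_nonpos mult_nonpos_nonneg)
  then show ?thesis by (rule order_trans) simp
qed

text \<open>This is quasi-concavity: a convex combination of the two potentials is at most their
  maximum. The values \<open>t = 0\<close>, \<open>t = 1\<close> and points of zero density are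
  handled directly, as \<open>log_concave_densityE\<close> does not reach them.\<close>

lemma log_concave_density_min:
  assumes \<rho>: "log_concave_density \<rho>" and t: "0 \<le> t" "t \<le> 1"
  shows "min (\<rho> x) (\<rho> y) \<le> \<rho> ((1 - t) *\<^sub>R x + t *\<^sub>R y)"
proof (cases "0 < \<rho> x \<and> 0 < \<rho> y \<and> 0 < t \<and> t < 1")
  case True
  then obtain a b where ab: "\<rho> x = exp (- a)" "\<rho> y = exp (- b)"
    "\<And>t. 0 < t \<Longrightarrow> t < 1 \<Longrightarrow> exp (- ((1 - t) * a + t * b)) \<le> \<rho> ((1 - t) *\<^sub>R x + t *\<^sub>R y)"
    using log_concave_densityE[OF \<rho>] by metis
  have "(1 - t) * a + t * b \<le> (1 - t) * max a b + t * max a b"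
    using t by (intro add_mono mult_left_mono) auto
  then have "(1 - t) * a + t * b \<le> max a b" by (simp add: algebra_simps)
  then have "exp (- max a b) \<le> exp (- ((1 - t) * a + t * b))" by simp
  also have "\<dots> \<le> \<rho> ((1 - t) *\<^sub>R x + t *\<^sub>R y)" using ab(3) True by auto
  finally show ?thesis unfolding ab by (auto simp: min_def max_def split: if_splits)
next
  case False
  then consider "\<rho> x \<le> 0" | "\<rho> y \<le> 0" | "t = 0" | "t = 1" using t by force
  then show ?thesis
    using log_concave_density_nonneg[OF \<rho>, of "(1 - t) *\<^sub>R x + t *\<^sub>R y"] by cases auto
qed

lemma convex_log_concave_superlevel:
  assumes "log_concave_density \<rho>"
  shows "convex {x. c \<le> \<rho> x}"
  unfolding convex_alt
proof (intro ballI allI impI)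
  fix x y t assume "x \<in> {x. c \<le> \<rho> x}" "y \<in> {x. c \<le> \<rho> x}" and t: "0 \<le> t \<and> t \<le> (1::real)"
  then have "c \<le> min (\<rho> x) (\<rho> y)" by simp
  also have "\<dots> \<le> \<rho> ((1 - t) *\<^sub>R x + t *\<^sub>R y)"
    using t by (intro log_concave_density_min[OF assms]) auto
  finally show "(1 - t) *\<^sub>R x + t *\<^sub>R y \<in> {x. c \<le> \<rho> x}" by simp
qed

section \<open>Integral bounds for log-concave densities\<close>

lemma nn_integral_half:
  fixes F :: "'a::euclidean_space \<Rightarrow> ennreal"
  assumes [measurable]: "F \<in> borel_measurable borel"
  shows "(\<integral>\<^sup>+x. F ((1/2) *\<^sub>R a + (1/2) *\<^sub>R x) \<partial>lborel) = 2 ^ DIM('a) * (\<integral>\<^sup>+x. F x \<partial>lborel)"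
proof -
  \<comment> \<open>The map sending \<open>x\<close> to the midpoint of \<open>a\<close> and
    \<open>x\<close> has Jacobian \<open>(1/2) ^ DIM('a)\<close>.\<close>
  have "(\<integral>\<^sup>+x. F x \<partial>lborel) = (\<integral>\<^sup>+x. F x \<partial>density (distr lborel borel (\<lambda>x. (1/2) *\<^sub>R a + (1/2) *\<^sub>R x)) (\<lambda>_. ennreal (\<bar>1/2\<bar> ^ DIM('a))))"
    by (subst lborel_affine[of "1/2" "(1/2) *\<^sub>R a"]) auto
  also have "\<dots> = ennreal ((1/2) ^ DIM('a)) * (\<integral>\<^sup>+x. F ((1/2) *\<^sub>R a + (1/2) *\<^sub>R x) \<partial>lborel)"
    by (simp add: nn_integral_density nn_integral_distr nn_integral_cmult)
  finally have "2 ^ DIM('a) * (\<integral>\<^sup>+x. F x \<partial>lborel)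
      = (ennreal (2 ^ DIM('a)) * ennreal ((1/2) ^ DIM('a))) * (\<integral>\<^sup>+x. F ((1/2) *\<^sub>R a + (1/2) *\<^sub>R x) \<partial>lborel)"
    by (simp add: mult.assoc ennreal_power[symmetric])
  also have "ennreal (2 ^ DIM('a)) * ennreal ((1/2) ^ DIM('a)) = 1"
    by (simp add: ennreal_mult[symmetric] power_mult_distrib[symmetric])
  finally show ?thesis by simp
qed

text \<open>Since the integral is not zero, some level set \<open>A = {x. c \<le> \<rho> x}\<close>
  has positive volume \<open>v\<close>. For every \<open>x\<close> the density is at least
  \<open>sqrt (c * \<rho> x)\<close> at all midpoints of \<open>x\<close> with points of
  \<open>A\<close>; integrating over \<open>A\<close> bounds \<open>sqrt (c * \<rho> x) * v\<close>
  by \<open>2 ^ DIM('a)\<close>.\<close>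

lemma log_concave_density_bounded:
  fixes \<rho> :: "'a::euclidean_space \<Rightarrow> real"
  assumes \<rho>: "log_concave_density \<rho>" and m[measurable]: "\<rho> \<in> borel_measurable borel"
    and int: "(\<integral>\<^sup>+x. ennreal (\<rho> x) \<partial>lborel) = 1"
  shows "\<exists>M. \<forall>x. \<rho> x \<le> M"
proof -
  note nn = log_concave_density_nonneg[OF \<rho>]
  have "\<exists>k. emeasure lborel {x. 1 / Suc k \<le> \<rho> x} \<noteq> 0"
  proof (rule ccontr)
    assume "\<not> ?thesis"
    then have "\<forall>k. AE x in lborel. \<not> 1 / Suc k \<le> \<rho> x"
      by (auto simp: AE_iff_measurable[OF _ refl])
    then have "AE x in lborel. \<forall>k. \<not> 1 / Suc k \<le> \<rho> x" by (simp add: AE_all_countable)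
    then have "AE x in lborel. \<rho> x = 0"
    proof eventually_elim
      case (elim x)
      show ?case
      proof (rule ccontr)
        assume "\<rho> x \<noteq> 0"
        then have "0 < \<rho> x" using nn[of x] by simp
        then obtain k where "inverse (real (Suc k)) < \<rho> x" using reals_Archimedean by blast
        with elim show False by (auto simp: inverse_eq_divide dest: less_imp_le)
      qed
    qed
    then have "(\<integral>\<^sup>+x. ennreal (\<rho> x) \<partial>lborel) = (\<integral>\<^sup>+x. 0 \<partial>(lborel::'a measure))"
      by (intro nn_integral_cong_AE) auto
    with int show False by simp
  qed
  then obtain k where k: "emeasure lborel {x. 1 / Suc k \<le> \<rho> x} \<noteq> 0" ..
  define c where "c = 1 / real (Suc k)"
  define A where "A = {x. c \<le> \<rho> x}"
  have c: "0 < c" by (simp add: c_def)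
  have A[measurable]: "A \<in> sets borel" by (simp add: A_def)
  have A0: "emeasure lborel A \<noteq> 0" using k by (simp add: A_def c_def)
  \<comment> \<open>Markov's inequality shows that the level set has finite volume.\<close>
  have "ennreal c * emeasure lborel A = (\<integral>\<^sup>+x. ennreal c * indicator A x \<partial>lborel)"
    by (simp add: nn_integral_cmult)
  also have "\<dots> \<le> (\<integral>\<^sup>+x. ennreal (\<rho> x) \<partial>lborel)"
    by (intro nn_integral_mono) (auto simp: A_def split: split_indicator intro: ennreal_leI)
  finally have "ennreal c * emeasure lborel A \<le> 1" using int by simp
  then have fin: "emeasure lborel A \<noteq> \<infinity>" using c by (auto simp: ennreal_mult_top top_unique)
  define v where "v = measure lborel A"
  have v: "emeasure lborel A = ennreal v" using fin by (simp add: v_def emeasure_eq_ennreal_measure)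
  have v0: "0 < v" using A0 v by (metis ennreal_eq_zero_iff less_eq_real_def v_def measure_nonneg)
  have "\<rho> x \<le> (2 ^ DIM('a) / v)\<^sup>2 / c" for x
  proof -
    have "ennreal (sqrt (c * \<rho> x)) * emeasure lborel A = (\<integral>\<^sup>+z. ennreal (sqrt (c * \<rho> x)) * indicator A z \<partial>lborel)"
      by (simp add: nn_integral_cmult)
    also have "\<dots> \<le> (\<integral>\<^sup>+z. ennreal (\<rho> ((1/2) *\<^sub>R x + (1/2) *\<^sub>R z)) \<partial>lborel)"
    proof (intro nn_integral_mono)
      fix z
      show "ennreal (sqrt (c * \<rho> x)) * indicator A z \<le> ennreal (\<rho> ((1/2) *\<^sub>R x + (1/2) *\<^sub>R z))"
      proof (cases "z \<in> A")
        case True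
        then have "c * \<rho> x \<le> \<rho> x * \<rho> z"
          using nn[of x] by (simp add: A_def mult.commute[of c] mult_left_mono)
        also have "\<dots> \<le> (\<rho> ((1/2) *\<^sub>R x + (1/2) *\<^sub>R z))\<^sup>2"
          by (rule log_concave_density_midpoint[OF \<rho>])
        finally have "sqrt (c * \<rho> x) \<le> \<rho> ((1/2) *\<^sub>R x + (1/2) *\<^sub>R z)"
          by (rule real_le_lsqrt[rotated]) (rule nn)
        then show ?thesis by (simp add: True ennreal_leI)
      qed simp
    qed
    also have "\<dots> = 2 ^ DIM('a)" by (subst nn_integral_half) (auto simp: int)
    finally have "ennreal (sqrt (c * \<rho> x) * v) \<le> ennreal (2 ^ DIM('a))"
      using v0 nn[of x] c by (simp add: v ennreal_mult ennreal_power[symmetric])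
    then have "sqrt (c * \<rho> x) \<le> 2 ^ DIM('a) / v" using v0 by (simp add: field_simps)
    then have "c * \<rho> x \<le> (2 ^ DIM('a) / v)\<^sup>2"
      using c nn[of x] by (meson real_sqrt_le_iff sqrt_le_D)
    then show ?thesis using c by (simp add: pos_le_divide_eq mult.commute)
  qed
  then show ?thesis by blast
qed

text \<open>If the difference set of \<open>K = {x. \<epsilon> * \<rho> x0 \<le> \<rho> x}\<close> missed \<open>h / 4\<close>, a separating hyperplane would
  confine \<open>K\<close> to a thin slab around \<open>x0\<close>. Outside the dilate of \<open>K\<close> from \<open>x0\<close> by the factor 2,
  \<open>\<rho> x\<close> is at most \<open>\<epsilon>\<close> times its value at the midpoint of \<open>x0\<close> and \<open>x\<close>, so half of the second
  moment across the slab is absorbed and the rest is too small for an isotropic measure.\<close>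

lemma isotropic_log_concave_segment:
  fixes \<rho> :: "'a::euclidean_space \<Rightarrow> real"
  assumes \<rho>: "log_concave_density \<rho>" and m[measurable]: "\<rho> \<in> borel_measurable borel"
    and iso: "isotropic_with_constant (density lborel (\<lambda>x. ennreal (\<rho> x))) 1"
    and x0: "0 < \<rho> x0" and h: "norm h = 1"
  defines "\<epsilon> \<equiv> 1 / 2 ^ (DIM('a) + 3)"
  shows "\<exists>p. \<epsilon> * \<rho> x0 \<le> \<rho> p \<and> \<epsilon> * \<rho> x0 \<le> \<rho> (p + (1/4) *\<^sub>R h)"
proof (rule ccontr)
  assume contr: "\<not> ?thesis"
  let ?\<mu> = "density lborel (\<lambda>x. ennreal (\<rho> x))"
  interpret prob_space ?\<mu> using iso by (simp add: isotropic_with_constant_def)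
  note nn = log_concave_density_nonneg[OF \<rho>]
  \<comment> \<open>The exponent is chosen to give
    \<open>4 * \<epsilon> * 2 ^ DIM('a) = 1/2\<close>, the share of the second moment that gets
    absorbed. The 4 arises because passing to the midpoint quarters \<open>q\<close>, the power of 2
    from \<open>nn_integral_half\<close>.\<close>
  have \<epsilon>: "0 < \<epsilon>" "\<epsilon> \<le> 1" by (auto simp: \<epsilon>_def)
  define K where "K = {x. \<epsilon> * \<rho> x0 \<le> \<rho> x}"
  have K: "convex K" unfolding K_def by (rule convex_log_concave_superlevel[OF \<rho>])
  have x0K: "x0 \<in> K" using \<epsilon> x0 by (simp add: K_def mult_le_cancel_right1)
  define S where "S = (\<Union>x\<in>K. \<Union>y\<in>K. {x - y})"
  have "(1/4) *\<^sub>R h \<notin> S"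
  proof
    assume "(1/4) *\<^sub>R h \<in> S"
    then obtain x y where "x \<in> K" "y \<in> K" "(1/4) *\<^sub>R h = x - y" by (auto simp: S_def)
    then have "y \<in> K" "y + (1/4) *\<^sub>R h \<in> K" by auto
    with contr show False by (auto simp: K_def)
  qed
  moreover have "convex S" unfolding S_def by (rule convex_differences[OF K K])
  moreover have "S \<noteq> {}" using x0K by (auto simp: S_def)
  ultimately obtain a b where a: "a \<noteq> 0" and b: "\<And>s. s \<in> S \<Longrightarrow> a \<bullet> s \<le> b" "b \<le> a \<bullet> ((1/4) *\<^sub>R h)"
    using separating_hyperplane_sets[of S "{(1/4) *\<^sub>R h}"] by auto
  define \<theta> where "\<theta> = a /\<^sub>R norm a"
  have \<theta>: "norm \<theta> = 1" using a by (simp add: \<theta>_def)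
  \<comment> \<open>Both \<open>x - x0\<close> and \<open>x0 - x\<close> lie in \<open>S\<close>,
    and Cauchy-Schwarz bounds the separating level \<open>b\<close> by \<open>norm a / 4\<close>. So
    \<open>K\<close> deviates from \<open>x0\<close> by at most 1/4 in direction
    \<open>\<theta>\<close>.\<close>
  have w: "((x - x0) \<bullet> \<theta>)\<^sup>2 \<le> 1/16" if x: "x \<in> K" for x
  proof -
    have bb: "b \<le> norm a / 4"
      using b(2) Cauchy_Schwarz_ineq2[of a h] h by (simp add: abs_le_iff)
    have "x - x0 \<in> S" "x0 - x \<in> S" using x x0K by (auto simp: S_def)
    from b(1)[OF this(1)] b(1)[OF this(2)] have "\<bar>(x - x0) \<bullet> a\<bar> \<le> norm a / 4"
      using bb by (simp add: inner_diff_right inner_diff_left inner_commute[of _ a] abs_if)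
    then have "\<bar>(x - x0) \<bullet> \<theta>\<bar> \<le> 1/4"
      using a by (simp add: \<theta>_def abs_mult divide_simps mult.commute)
    then have "\<bar>(x - x0) \<bullet> \<theta>\<bar>\<^sup>2 \<le> (1/4)\<^sup>2" by (intro power_mono) auto
    then show ?thesis by (simp add: power2_eq_square)
  qed
  define q where "q = (\<lambda>x. ((x - x0) \<bullet> \<theta>)\<^sup>2)"
  have q[measurable]: "q \<in> borel_measurable borel" by (simp add: q_def)
  have q0: "0 \<le> q x" for x by (simp add: q_def)
  define J where "J = (\<integral>\<^sup>+x. ennreal (\<rho> x * q x) \<partial>lborel)"
  have int1: "(\<integral>\<^sup>+x. ennreal (\<rho> x) \<partial>lborel) = 1"
    using emeasure_space_1 by (simp add: emeasure_density)
  \<comment> \<open>Mean zero and unit variance give the second moment about \<open>x0\<close>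
    exactly. Its finiteness is what allows half of it to be absorbed at the end.\<close>
  have J: "J = ennreal (1 + (x0 \<bullet> \<theta>)\<^sup>2)"
  proof -
    have i: "integrable ?\<mu> (\<lambda>x. x \<bullet> \<theta>)" "(\<integral>x. x \<bullet> \<theta> \<partial>?\<mu>) = 0"
      "integrable ?\<mu> (\<lambda>x. (x \<bullet> \<theta>)\<^sup>2)" "(\<integral>x. (x \<bullet> \<theta>)\<^sup>2 \<partial>?\<mu>) = 1"
      using iso \<theta> by (auto simp: isotropic_with_constant_def)
    have qe: "q = (\<lambda>x. (x \<bullet> \<theta>)\<^sup>2 - 2 * (x0 \<bullet> \<theta>) * (x \<bullet> \<theta>) + (x0 \<bullet> \<theta>)\<^sup>2)"
      by (auto simp: q_def inner_diff_left power2_eq_square algebra_simps)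
    have "integrable ?\<mu> q" unfolding qe by (intro Bochner_Integration.integrable_add Bochner_Integration.integrable_diff integrable_mult_right i integrable_const)
    moreover have "(\<integral>x. q x \<partial>?\<mu>) = 1 + (x0 \<bullet> \<theta>)\<^sup>2"
      unfolding qe using i prob_space by simp
    ultimately have "(\<integral>\<^sup>+x. ennreal (q x) \<partial>?\<mu>) = ennreal (1 + (x0 \<bullet> \<theta>)\<^sup>2)"
      using nn_integral_eq_integral[of ?\<mu> q] q0 by simp
    then show ?thesis unfolding J_def
      by (simp add: nn_integral_density ennreal_mult nn q0)
  qed
  have "J \<le> (\<integral>\<^sup>+x. ennreal (1/4) * ennreal (\<rho> x) + ennreal (4 * \<epsilon>) *
      ennreal (\<rho> ((1/2) *\<^sub>R x0 + (1/2) *\<^sub>R x) * q ((1/2) *\<^sub>R x0 + (1/2) *\<^sub>R x)) \<partial>lborel)"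
    unfolding J_def
  proof (rule nn_integral_mono)
    fix x
    let ?y = "(1/2) *\<^sub>R x0 + (1/2) *\<^sub>R x"
    have "?y - x0 = (1/2) *\<^sub>R (x - x0)"
      by (simp add: algebra_simps) (simp flip: scaleR_add_left)
    then have qy: "q x = 4 * q ?y" by (simp add: q_def power2_eq_square)
    \<comment> \<open>If the midpoint lies in \<open>K\<close>, the slab bound gives
      \<open>q x \<le> 1/4\<close>. Otherwise \<open>\<rho> ?y \<le> \<epsilon> * \<rho> x0\<close>,
      and midpoint log-concavity turns this into
      \<open>\<rho> x \<le> \<epsilon> * \<rho> ?y\<close>.\<close>
    have "\<rho> x * q x \<le> 1/4 * \<rho> x + 4 * \<epsilon> * (\<rho> ?y * q ?y)"
    proof (cases "?y \<in> K")
      case True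
      from w[OF True] have "q x \<le> 1/4" unfolding qy by (simp add: q_def)
      then have "\<rho> x * q x \<le> \<rho> x * (1/4)" by (intro mult_left_mono nn)
      moreover have "0 \<le> 4 * \<epsilon> * (\<rho> ?y * q ?y)" using \<epsilon> nn[of ?y] q0[of ?y] by simp
      ultimately show ?thesis by simp
    next
      case False
      then have "\<rho> ?y \<le> \<epsilon> * \<rho> x0" by (simp add: K_def)
      then have "\<rho> ?y * \<rho> ?y \<le> \<rho> ?y * (\<epsilon> * \<rho> x0)" by (intro mult_left_mono nn)
      then have "\<rho> x0 * \<rho> x \<le> \<rho> x0 * (\<epsilon> * \<rho> ?y)"
        using log_concave_density_midpoint[OF \<rho>, of x0 x] by (simp add: power2_eq_square mult_ac)
      then have "\<rho> x \<le> \<epsilon> * \<rho> ?y" using x0 by simp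
      then have "\<rho> x * q x \<le> \<epsilon> * \<rho> ?y * q x" by (intro mult_right_mono q0)
      then show ?thesis using nn[of x] by (simp add: qy mult_ac)
    qed
    then show "ennreal (\<rho> x * q x) \<le> ennreal (1/4) * ennreal (\<rho> x) + ennreal (4 * \<epsilon>) * ennreal (\<rho> ?y * q ?y)"
      using nn[of x] nn[of ?y] q0[of ?y] \<epsilon> by (simp flip: ennreal_mult ennreal_plus)
  qed
  also have "\<dots> = ennreal (1/4) + ennreal (4 * \<epsilon>) * (2 ^ DIM('a) * J)"
    unfolding J_def
    by (simp add: nn_integral_add nn_integral_cmult int1 nn_integral_half[where F="\<lambda>x. ennreal (\<rho> x * q x)"])
  also have "\<dots> = ennreal (1/4 + 1/2 * (1 + (x0 \<bullet> \<theta>)\<^sup>2))"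
  proof -
    have "ennreal (4 * \<epsilon>) * (2 ^ DIM('a) * J) = ennreal (4 * \<epsilon> * 2 ^ DIM('a) * (1 + (x0 \<bullet> \<theta>)\<^sup>2))"
      unfolding J using \<epsilon> by (simp add: ennreal_mult mult.assoc ennreal_power[symmetric])
    also have "4 * \<epsilon> * 2 ^ DIM('a) = 1/2" by (simp add: \<epsilon>_def power_add)
    finally show ?thesis by (simp flip: ennreal_plus)
  qed
  finally have "1 + (x0 \<bullet> \<theta>)\<^sup>2 \<le> 1/4 + 1/2 * (1 + (x0 \<bullet> \<theta>)\<^sup>2)"
    unfolding J by (subst (asm) ennreal_le_iff) auto
  moreover have "\<not> 1 + u \<le> 1/4 + 1/2 * (1 + u)" if "0 \<le> u" for u :: real
    using that by (simp add: field_simps)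
  ultimately show False using zero_le_power2 by blast
qed

text \<open>The right side depends only on the line and not on the point
  \<open>x + q *\<^sub>R h\<close>, so it bounds the supremum along the line. Averaging this point
  with a segment of length 1/4 of high density yields a parameter interval on which the integrand is
  comparable to \<open>\<rho> (x + q *\<^sub>R h)\<close>.\<close>

lemma isotropic_log_concave_line_bound:
  fixes \<rho> :: "'a::euclidean_space \<Rightarrow> real"
  assumes \<rho>: "log_concave_density \<rho>" and m[measurable]: "\<rho> \<in> borel_measurable borel"
    and iso: "isotropic_with_constant (density lborel (\<lambda>x. ennreal (\<rho> x))) 1"
    and h: "norm h = 1"
  shows "\<exists>p. \<forall>x q. ennreal (\<rho> (x + q *\<^sub>R h)) \<le>
    ennreal (2 ^ (DIM('a) + 6)) * (\<integral>\<^sup>+t. ennreal (\<rho> ((1/2) *\<^sub>R p + (1/2) *\<^sub>R (x + t *\<^sub>R h))) \<partial>lborel)"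
proof -
  let ?\<mu> = "density lborel (\<lambda>x. ennreal (\<rho> x))"
  interpret prob_space ?\<mu> using iso by (simp add: isotropic_with_constant_def)
  note nn = log_concave_density_nonneg[OF \<rho>]
  have int1: "(\<integral>\<^sup>+x. ennreal (\<rho> x) \<partial>lborel) = 1"
    using emeasure_space_1 by (simp add: emeasure_density)
  obtain M where M: "\<And>x. \<rho> x \<le> M" using log_concave_density_bounded[OF \<rho> m int1] by blast
  have bdd: "bdd_above (range \<rho>)" using M by (auto simp: bdd_above_def)
  obtain y where y: "0 < \<rho> y"
  proof (rule ccontr)
    assume "\<not> thesis"
    then have "\<rho> x = 0" for x using that[of x] nn[of x] by (cases "\<rho> x = 0") auto
    with int1 show False by simp
  qed
  \<comment> \<open>The supremum may fail to be attained; a point with more than half of it gives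
    \<open>\<rho> \<le> 2 * \<rho> x0\<close> everywhere.\<close>
  define s where "s = (SUP x. \<rho> x)"
  have s: "\<rho> x \<le> s" for x unfolding s_def by (rule cSUP_upper[OF _ bdd]) simp
  have "s / 2 < s" using s[of y] y by simp
  then have "\<exists>x0. s / 2 < \<rho> x0"
    using less_cSUP_iff[OF _ bdd, of "s / 2"] by (simp flip: s_def)
  then obtain x0 where x0: "s / 2 < \<rho> x0" ..
  have "0 < \<rho> x0" using x0 s[of y] y by simp
  define \<epsilon> :: real where "\<epsilon> = 1 / 2 ^ (DIM('a) + 3)"
  have \<epsilon>: "0 < \<epsilon>" "\<epsilon> \<le> 1" by (auto simp: \<epsilon>_def)
  obtain p where p: "\<epsilon> * \<rho> x0 \<le> \<rho> p" "\<epsilon> * \<rho> x0 \<le> \<rho> (p + (1/4) *\<^sub>R h)"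
    using isotropic_log_concave_segment[OF \<rho> m iso \<open>0 < \<rho> x0\<close> h] unfolding \<epsilon>_def by blast
  have "ennreal (\<rho> (x + q *\<^sub>R h)) \<le> ennreal (2 ^ (DIM('a) + 6)) *
      (\<integral>\<^sup>+t. ennreal (\<rho> ((1/2) *\<^sub>R p + (1/2) *\<^sub>R (x + t *\<^sub>R h))) \<partial>lborel)" for x q
  proof -
    let ?y = "x + q *\<^sub>R h"
    \<comment> \<open>The point \<open>?z\<close> runs through the segment at parameter
      \<open>t - q\<close>. The shift by \<open>q\<close> cancels in the midpoint of
      \<open>?z\<close> and \<open>?y\<close>, which is also the midpoint of \<open>p\<close> and
      \<open>x + t *\<^sub>R h\<close>.\<close>
    have mid: "\<epsilon> / 2 * \<rho> ?y \<le> \<rho> ((1/2) *\<^sub>R p + (1/2) *\<^sub>R (x + t *\<^sub>R h))" if t: "t \<in> {q..q + 1/4}" for t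
    proof -
      let ?z = "p + (t - q) *\<^sub>R h"
      have "min (\<rho> p) (\<rho> (p + (1/4) *\<^sub>R h)) \<le> \<rho> ((1 - 4 * (t - q)) *\<^sub>R p + (4 * (t - q)) *\<^sub>R (p + (1/4) *\<^sub>R h))"
        by (rule log_concave_density_min[OF \<rho>]) (use t in auto)
      also have "(1 - 4 * (t - q)) *\<^sub>R p + (4 * (t - q)) *\<^sub>R (p + (1/4) *\<^sub>R h) = ?z"
        by (simp add: algebra_simps)
      finally have z: "\<epsilon> * \<rho> x0 \<le> \<rho> ?z" using p by linarith
      have "\<rho> ?y \<le> 2 * \<rho> x0" using s[of ?y] x0 by linarith
      then have "\<epsilon> * \<rho> ?y \<le> \<epsilon> * (2 * \<rho> x0)" using \<epsilon> by (intro mult_left_mono) auto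
      then have e: "\<epsilon> / 2 * \<rho> ?y \<le> \<rho> ?z" using z by simp
      \<comment> \<open>Both \<open>\<rho> ?z\<close> and \<open>\<rho> ?y\<close> are at least
        \<open>\<epsilon> / 2 * \<rho> ?y\<close>, hence so is their geometric mean, and
        log-concavity hands this to the midpoint.\<close>
      have "\<epsilon> / 2 * \<rho> ?y \<le> 1 * \<rho> ?y" using \<epsilon> nn[of ?y] by (intro mult_right_mono) auto
      then have "(\<epsilon> / 2 * \<rho> ?y)\<^sup>2 \<le> \<rho> ?z * \<rho> ?y"
        unfolding power2_eq_square using e \<epsilon> nn[of ?y] nn[of ?z] by (intro mult_mono) auto
      also have "\<dots> \<le> (\<rho> ((1/2) *\<^sub>R ?z + (1/2) *\<^sub>R ?y))\<^sup>2" by (rule log_concave_density_midpoint[OF \<rho>])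
      also have "(1/2) *\<^sub>R ?z + (1/2) *\<^sub>R ?y = (1/2) *\<^sub>R p + (1/2) *\<^sub>R (x + t *\<^sub>R h)"
        by (simp add: algebra_simps)
      finally show ?thesis using power2_le_imp_le nn by blast
    qed
    \<comment> \<open>The length 1/4 of the parameter interval turns \<open>\<epsilon> / 2\<close>
      into \<open>\<epsilon> / 8\<close>, and \<open>8 / \<epsilon>\<close> is the constant of the
      claim.\<close>
    have "ennreal (\<epsilon> / 8 * \<rho> ?y) = ennreal (\<epsilon> / 2 * \<rho> ?y) * emeasure lborel {q..q + 1/4}"
      using nn[of ?y] \<epsilon> by (simp flip: ennreal_mult)
    also have "\<dots> = (\<integral>\<^sup>+t. ennreal (\<epsilon> / 2 * \<rho> ?y) * indicator {q..q + 1/4} t \<partial>lborel)"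
      by (simp add: nn_integral_cmult)
    also have "\<dots> \<le> (\<integral>\<^sup>+t. ennreal (\<rho> ((1/2) *\<^sub>R p + (1/2) *\<^sub>R (x + t *\<^sub>R h))) \<partial>lborel)"
      by (intro nn_integral_mono) (use mid in \<open>auto split: split_indicator intro: ennreal_leI\<close>)
    finally have "ennreal (8 / \<epsilon>) * ennreal (\<epsilon> / 8 * \<rho> ?y) \<le> ennreal (8 / \<epsilon>) *
        (\<integral>\<^sup>+t. ennreal (\<rho> ((1/2) *\<^sub>R p + (1/2) *\<^sub>R (x + t *\<^sub>R h))) \<partial>lborel)"
      by (rule mult_left_mono) simp
    moreover have "ennreal (8 / \<epsilon>) * ennreal (\<epsilon> / 8 * \<rho> ?y) = ennreal (\<rho> ?y)"
      using nn[of ?y] \<epsilon> by (simp flip: ennreal_mult)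
    moreover have "8 / \<epsilon> = 2 ^ (DIM('a) + 6)" by (simp add: \<epsilon>_def power_add)
    ultimately show ?thesis by simp
  qed
  then show ?thesis by blast
qed

subsection \<open>The derivative as a difference of endpoint measures\<close>

text \<open>The coordinates of \<open>w\<close> are a base point \<open>x\<close> in the slab, a
  level \<open>r\<close> and a line parameter \<open>t\<close>. Integrating over \<open>r\<close>
  first produces the density at \<open>x + t *\<^sub>R h\<close>, and
  \<open>nn_integral_slab_lines\<close> does the rest. Grouping \<open>x\<close> with
  \<open>r\<close> leaves \<open>t\<close> as the innermost variable for later use.\<close>

lemma nn_integral_layer_cake_lines:
  fixes \<rho> :: "'a::euclidean_space \<Rightarrow> real" and f :: "'a \<Rightarrow> ennreal"
  assumes h: "norm h = 1" and [measurable]: "\<rho> \<in> borel_measurable borel" "f \<in> borel_measurable borel"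
    and nn: "\<And>x. 0 \<le> \<rho> x"
  shows "(\<integral>\<^sup>+w. indicator {w. fst (fst w) \<in> slab h \<and> 0 < snd (fst w) \<and>
      snd (fst w) < \<rho> (fst (fst w) + snd w *\<^sub>R h)} w * f (fst (fst w) + snd w *\<^sub>R h)
      \<partial>((lborel \<Otimes>\<^sub>M lborel) \<Otimes>\<^sub>M lborel)) = (\<integral>\<^sup>+x. ennreal (\<rho> x) * f x \<partial>lborel)"
    (is "(\<integral>\<^sup>+w. ?F w \<partial>_) = _")
proof -
  have [measurable]: "?F \<in> borel_measurable ((lborel \<Otimes>\<^sub>M lborel) \<Otimes>\<^sub>M lborel)" by measurable
  have "(\<integral>\<^sup>+w. ?F w \<partial>((lborel \<Otimes>\<^sub>M lborel) \<Otimes>\<^sub>M lborel))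
      = (\<integral>\<^sup>+z. \<integral>\<^sup>+t. ?F (z, t) \<partial>lborel \<partial>(lborel \<Otimes>\<^sub>M lborel))"
    by (rule lborel.nn_integral_fst[symmetric]) measurable
  also have "\<dots> = (\<integral>\<^sup>+x. \<integral>\<^sup>+r. \<integral>\<^sup>+t. ?F ((x, r), t) \<partial>lborel \<partial>lborel \<partial>lborel)"
    by (rule lborel.nn_integral_fst[symmetric]) measurable
  also have "\<dots> = (\<integral>\<^sup>+x. \<integral>\<^sup>+t. indicator (slab h) x * (ennreal (\<rho> (x + t *\<^sub>R h)) * f (x + t *\<^sub>R h)) \<partial>lborel \<partial>lborel)"
  proof (rule nn_integral_cong)
    fix x :: 'a
    have "(\<integral>\<^sup>+r. \<integral>\<^sup>+t. ?F ((x, r), t) \<partial>lborel \<partial>lborel) = (\<integral>\<^sup>+t. \<integral>\<^sup>+r. ?F ((x, r), t) \<partial>lborel \<partial>lborel)"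
      by (rule lborel_pair.Fubini') measurable
    also have "\<dots> = (\<integral>\<^sup>+t. indicator (slab h) x * (ennreal (\<rho> (x + t *\<^sub>R h)) * f (x + t *\<^sub>R h)) \<partial>lborel)"
    proof (rule nn_integral_cong)
      fix t
      have "(\<integral>\<^sup>+r. ?F ((x, r), t) \<partial>lborel)
          = (\<integral>\<^sup>+r. indicator (slab h) x * f (x + t *\<^sub>R h) * indicator {0<..<\<rho> (x + t *\<^sub>R h)} r \<partial>lborel)"
        by (rule nn_integral_cong) (auto split: split_indicator)
      also have "\<dots> = indicator (slab h) x * (ennreal (\<rho> (x + t *\<^sub>R h)) * f (x + t *\<^sub>R h))"
        using nn by (simp add: nn_integral_cmult mult_ac)
      finally show "(\<integral>\<^sup>+r. ?F ((x, r), t) \<partial>lborel)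
        = indicator (slab h) x * (ennreal (\<rho> (x + t *\<^sub>R h)) * f (x + t *\<^sub>R h))" .
    qed
    finally show "(\<integral>\<^sup>+r. \<integral>\<^sup>+t. ?F ((x, r), t) \<partial>lborel \<partial>lborel)
      = (\<integral>\<^sup>+t. indicator (slab h) x * (ennreal (\<rho> (x + t *\<^sub>R h)) * f (x + t *\<^sub>R h)) \<partial>lborel)" .
  qed
  also have "\<dots> = (\<integral>\<^sup>+x. ennreal (\<rho> x) * f x \<partial>lborel)"
    by (rule nn_integral_slab_lines[OF h, where F="\<lambda>y. ennreal (\<rho> y) * f y"]) measurable
  finally show ?thesis .
qed

section \<open>Line sections of the level sets and their endpoints\<close>

definition level_section :: "('a::euclidean_space \<Rightarrow> real) \<Rightarrow> 'a \<Rightarrow> 'a \<times> real \<Rightarrow> real set" where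
  "level_section \<rho> h z = {t. snd z < \<rho> (fst z + t *\<^sub>R h)}"

text \<open>The fibres \<open>{(x + t *\<^sub>R h, r) | t. r < \<rho> (x + t *\<^sub>R h)}\<close> of the hypograph of \<open>\<rho>\<close> in direction \<open>h\<close>,
  parametrised by \<open>(x, r)\<close> and restricted to those whose two endpoints are defined.\<close>

definition level_lines :: "('a::euclidean_space \<Rightarrow> real) \<Rightarrow> 'a \<Rightarrow> ('a \<times> real) set" where
  "level_lines \<rho> h = {z. fst z \<in> slab h \<and> 0 < snd z \<and>
     \<bar>rat_inf (level_section \<rho> h z)\<bar> \<noteq> \<infinity> \<and> \<bar>rat_sup (level_section \<rho> h z)\<bar> \<noteq> \<infinity>}"

lemma convex_level_section:
  assumes \<rho>: "log_concave_density \<rho>"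
  shows "convex (level_section \<rho> h z)"
  unfolding convex_alt
proof (intro ballI allI impI)
  fix s t u assume s: "s \<in> level_section \<rho> h z" and t: "t \<in> level_section \<rho> h z"
    and u: "0 \<le> u \<and> u \<le> (1::real)"
  have "min (\<rho> (fst z + s *\<^sub>R h)) (\<rho> (fst z + t *\<^sub>R h))
      \<le> \<rho> ((1 - u) *\<^sub>R (fst z + s *\<^sub>R h) + u *\<^sub>R (fst z + t *\<^sub>R h))"
    using u by (intro log_concave_density_min[OF \<rho>]) auto
  also have "(1 - u) *\<^sub>R (fst z + s *\<^sub>R h) + u *\<^sub>R (fst z + t *\<^sub>R h)
      = fst z + ((1 - u) *\<^sub>R s + u *\<^sub>R t) *\<^sub>R h"
    by (simp add: algebra_simps)
  finally show "(1 - u) *\<^sub>R s + u *\<^sub>R t \<in> level_section \<rho> h z"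
    using s t by (auto simp: level_section_def min_def split: if_splits)
qed

text \<open>For each fixed rational, membership in the section is a measurable condition on
  \<open>z\<close>, and extrema over countably many such functions remain measurable.\<close>

lemma measurable_level_section [measurable]:
  fixes \<rho> :: "'a::euclidean_space \<Rightarrow> real"
  assumes [measurable]: "\<rho> \<in> borel_measurable borel"
  shows "(\<lambda>z. rat_inf (level_section \<rho> h z)) \<in> borel_measurable (lborel \<Otimes>\<^sub>M lborel)"
    "(\<lambda>z. rat_sup (level_section \<rho> h z)) \<in> borel_measurable (lborel \<Otimes>\<^sub>M lborel)"
  unfolding rat_inf_def rat_sup_def level_section_def mem_Collect_eq
  by (intro borel_measurable_INF borel_measurable_SUP countable_rat; measurable)+

lemma level_lines_sets [measurable]:
  fixes \<rho> :: "'a::euclidean_space \<Rightarrow> real"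
  assumes [measurable]: "\<rho> \<in> borel_measurable borel"
  shows "level_lines \<rho> h \<in> sets (lborel \<Otimes>\<^sub>M lborel)"
proof -
  have "level_lines \<rho> h = {z \<in> space (lborel \<Otimes>\<^sub>M lborel). fst z \<in> slab h \<and> 0 < snd z \<and>
     \<bar>rat_inf (level_section \<rho> h z)\<bar> \<noteq> \<infinity> \<and> \<bar>rat_sup (level_section \<rho> h z)\<bar> \<noteq> \<infinity>}"
    by (simp add: level_lines_def space_pair_measure)
  also have "\<dots> \<in> sets (lborel \<Otimes>\<^sub>M lborel)" by measurable
  finally show ?thesis .
qed

text \<open>For fixed \<open>x\<close> only levels \<open>r\<close> in \<open>(0, G]\<close>
  contribute, where \<open>G\<close> is the integral of \<open>F\<close> along the line: a finite
  \<open>rat_inf\<close> supplies a rational \<open>q\<close> with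
  \<open>r < \<rho> (x + q *\<^sub>R h)\<close>, which is at most \<open>G\<close>.\<close>

lemma emeasure_level_lines_le:
  fixes \<rho> :: "'a::euclidean_space \<Rightarrow> real"
  assumes h: "norm h = 1" and [measurable]: "\<rho> \<in> borel_measurable borel" "F \<in> borel_measurable borel"
    and le: "\<And>x q. ennreal (\<rho> (x + q *\<^sub>R h)) \<le> (\<integral>\<^sup>+t. F (x + t *\<^sub>R h) \<partial>lborel)"
  shows "emeasure (lborel \<Otimes>\<^sub>M lborel) (level_lines \<rho> h) \<le> (\<integral>\<^sup>+x. F x \<partial>lborel)"
proof -
  have "emeasure (lborel \<Otimes>\<^sub>M lborel) (level_lines \<rho> h)
      = (\<integral>\<^sup>+z. indicator (level_lines \<rho> h) z \<partial>(lborel \<Otimes>\<^sub>M lborel))"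
    by (rule nn_integral_indicator[symmetric]) measurable
  also have "\<dots> = (\<integral>\<^sup>+x. \<integral>\<^sup>+r. indicator (level_lines \<rho> h) (x, r) \<partial>lborel \<partial>lborel)"
    by (rule lborel.nn_integral_fst[symmetric]) measurable
  also have "\<dots> \<le> (\<integral>\<^sup>+x. \<integral>\<^sup>+t. indicator (slab h) x * F (x + t *\<^sub>R h) \<partial>lborel \<partial>lborel)"
  proof (rule nn_integral_mono)
    fix x :: 'a
    define G where "G = (\<integral>\<^sup>+t. F (x + t *\<^sub>R h) \<partial>lborel)"
    have sub: "x \<in> slab h \<and> 0 < r \<and> ennreal r \<le> G" if "(x, r) \<in> level_lines \<rho> h" for r
    proof -
      have "level_section \<rho> h (x, r) \<inter> \<rat> \<noteq> {}"
        using that rat_inf_no_rats by (auto simp: level_lines_def)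
      then obtain q where "r < \<rho> (x + q *\<^sub>R h)" by (auto simp: level_section_def)
      then have "ennreal r \<le> G" unfolding G_def using le[of x q] by (meson ennreal_leI less_imp_le order_trans)
      with that show ?thesis by (auto simp: level_lines_def)
    qed
    have "(\<integral>\<^sup>+r. indicator (level_lines \<rho> h) (x, r) \<partial>lborel) \<le> indicator (slab h) x * G"
    proof (cases G)
      case top
      \<comment> \<open>For \<open>x\<close> in the slab the right side is infinite; for any other
        \<open>x\<close> the left side vanishes.\<close>
      then show ?thesis using sub
        by (cases "x \<in> slab h") (auto simp: ennreal_mult_top nn_integral_0_iff_AE split: split_indicator)
    next
      case (real \<gamma>)
      have "(\<integral>\<^sup>+r. indicator (level_lines \<rho> h) (x, r) \<partial>lborel)
          \<le> (\<integral>\<^sup>+r. indicator (slab h) x * indicator {0..\<gamma>} r \<partial>lborel)"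
        using sub real by (intro nn_integral_mono) (auto split: split_indicator dest: less_imp_le)
      also have "\<dots> = indicator (slab h) x * G" using real by (simp add: nn_integral_cmult)
      finally show ?thesis .
    qed
    also have "\<dots> = (\<integral>\<^sup>+t. indicator (slab h) x * F (x + t *\<^sub>R h) \<partial>lborel)"
      unfolding G_def by (rule nn_integral_cmult[symmetric]) measurable
    finally show "(\<integral>\<^sup>+r. indicator (level_lines \<rho> h) (x, r) \<partial>lborel)
      \<le> (\<integral>\<^sup>+t. indicator (slab h) x * F (x + t *\<^sub>R h) \<partial>lborel)" .
  qed
  also have "\<dots> = (\<integral>\<^sup>+x. F x \<partial>lborel)" by (rule nn_integral_slab_lines[OF h]) measurable
  finally show ?thesis .
qed

text \<open>Once the line parameter is innermost, the directional derivative is an ordinary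
  derivative in \<open>t\<close> integrated over one section, and the fundamental theorem of
  calculus leaves the values of \<open>\<phi>\<close> at the two endpoints.\<close>

lemma integral_directional_derivative:
  fixes \<rho> :: "'a::euclidean_space \<Rightarrow> real" and \<phi> g :: "'a \<Rightarrow> real"
  assumes \<rho>: "log_concave_density \<rho>" and m[measurable]: "\<rho> \<in> borel_measurable borel"
    and int1: "(\<integral>\<^sup>+x. ennreal (\<rho> x) \<partial>lborel) = 1"
    and h: "norm h = 1"
    and \<phi>: "\<And>x. \<phi> differentiable (at x)"
    and g: "\<And>x. g x = frechet_derivative \<phi> (at x) h"
    and gc: "continuous_on UNIV g" and gb: "\<And>x. \<bar>g x\<bar> \<le> B"
  defines "a \<equiv> \<lambda>z. real_of_ereal (rat_inf (level_section \<rho> h z))"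
    and "b \<equiv> \<lambda>z. real_of_ereal (rat_sup (level_section \<rho> h z))"
  shows "(\<integral>x. g x \<partial>density lborel (\<lambda>x. ennreal (\<rho> x))) =
    (\<integral>z. indicator (level_lines \<rho> h) z * (\<phi> (fst z + b z *\<^sub>R h) - \<phi> (fst z + a z *\<^sub>R h)) \<partial>(lborel \<Otimes>\<^sub>M lborel))"
proof -
  note nn = log_concave_density_nonneg[OF \<rho>]
  let ?L2 = "lborel \<Otimes>\<^sub>M lborel :: ('a \<times> real) measure"
  let ?L3 = "?L2 \<Otimes>\<^sub>M (lborel :: real measure)"
  interpret P: pair_sigma_finite ?L2 "lborel :: real measure"
    unfolding lborel_prod ..
  have gm[measurable]: "g \<in> borel_measurable borel" by (rule borel_measurable_continuous_onI[OF gc])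
  define E where "E = {w::('a \<times> real) \<times> real. fst (fst w) \<in> slab h \<and> 0 < snd (fst w) \<and>
      snd (fst w) < \<rho> (fst (fst w) + snd w *\<^sub>R h)}"
  define T where "T = (\<lambda>w::('a \<times> real) \<times> real. fst (fst w) + snd w *\<^sub>R h)"
  have E[measurable]: "E \<in> sets ?L3"
  proof -
    have "E = {w \<in> space ?L3. fst (fst w) \<in> slab h \<and> 0 < snd (fst w) \<and>
      snd (fst w) < \<rho> (fst (fst w) + snd w *\<^sub>R h)}"
      by (simp add: E_def space_pair_measure)
    also have "\<dots> \<in> sets ?L3" by measurable
    finally show ?thesis .
  qed
  have T[measurable]: "T \<in> borel_measurable ?L3" unfolding T_def by measurable
  let ?\<mu> = "density lborel (\<lambda>x. ennreal (\<rho> x))"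
  \<comment> \<open>The measure is the image under \<open>T\<close> of Lebesgue measure on the
    sliced hypograph \<open>E\<close>, so integrals against it become integrals over
    \<open>E\<close>.\<close>
  have \<mu>: "?\<mu> = distr (density ?L3 (\<lambda>w. ennreal (indicator E w))) borel T"
  proof (rule measure_eqI)
    fix A assume "A \<in> sets ?\<mu>"
    then have A[measurable]: "A \<in> sets borel" by simp
    have "emeasure (distr (density ?L3 (\<lambda>w. ennreal (indicator E w))) borel T) A
        = emeasure (density ?L3 (\<lambda>w. ennreal (indicator E w))) (T -` A \<inter> space ?L3)"
      by (subst emeasure_distr) simp_all
    also have "\<dots> = (\<integral>\<^sup>+w. ennreal (indicator E w) * indicator (T -` A \<inter> space ?L3) w \<partial>?L3)"
      by (rule emeasure_density) measurable
    also have "\<dots> = (\<integral>\<^sup>+w. indicator E w * indicator A (T w) \<partial>?L3)"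
      by (rule nn_integral_cong) (auto split: split_indicator)
    also have "\<dots> = (\<integral>\<^sup>+x. ennreal (\<rho> x) * indicator A x \<partial>lborel)"
      unfolding E_def T_def by (rule nn_integral_layer_cake_lines[OF h]) (auto simp: nn)
    finally show "emeasure ?\<mu> A = emeasure (distr (density ?L3 (\<lambda>w. ennreal (indicator E w))) borel T) A"
      by (simp add: emeasure_density)
  qed simp
  have fin: "finite_measure ?\<mu>"
    by (rule finite_measureI) (simp add: emeasure_density int1)
  have int: "integrable ?L3 (\<lambda>w. indicator E w * f (T w))"
    if [measurable]: "f \<in> borel_measurable borel" and "\<And>x. \<bar>f x\<bar> \<le> C" for f :: "'a \<Rightarrow> real" and C
  proof -
    have "integrable ?\<mu> f"
      by (rule finite_measure.integrable_const_bound[OF fin, of _ C]) (use that in auto)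
    then have "integrable (density ?L3 (\<lambda>w. ennreal (indicator E w))) (\<lambda>w. f (T w))"
      unfolding \<mu> by (subst (asm) integrable_distr_eq) auto
    then show ?thesis by (subst (asm) integrable_density) auto
  qed
  have "(\<integral>x. g x \<partial>?\<mu>) = (\<integral>w. indicator E w * g (T w) \<partial>?L3)"
    unfolding \<mu> by (subst integral_distr) (auto simp: integral_density)
  also have "\<dots> = (\<integral>z. \<integral>t. indicator E (z, t) * g (T (z, t)) \<partial>lborel \<partial>?L2)"
    by (rule P.integral_fst'[symmetric, OF int[OF gm gb]])
  also have "\<dots> = (\<integral>z. indicator (level_lines \<rho> h) z * (\<phi> (fst z + b z *\<^sub>R h) - \<phi> (fst z + a z *\<^sub>R h)) \<partial>?L2)"
  proof (rule integral_cong_AE)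
    have \<phi>m[measurable]: "\<phi> \<in> borel_measurable borel"
      by (intro borel_measurable_continuous_onI continuous_at_imp_continuous_on ballI
        differentiable_imp_continuous_within \<phi>)
    show "(\<lambda>z. \<integral>t. indicator E (z, t) * g (T (z, t)) \<partial>lborel) \<in> borel_measurable ?L2"
      using P.integrable_fst'[OF int[OF gm gb]] by simp
    show "(\<lambda>z. indicator (level_lines \<rho> h) z * (\<phi> (fst z + b z *\<^sub>R h) - \<phi> (fst z + a z *\<^sub>R h)))
        \<in> borel_measurable ?L2"
      unfolding a_def b_def by measurable
    \<comment> \<open>The total mass is finite, so the constant function 1 is integrable over
      \<open>E\<close>. Hence almost every section of \<open>E\<close> has finite length, as the
      fundamental theorem requires.\<close>
    have "AE z in ?L2. integrable lborel (\<lambda>t. indicator E (z, t) * (1::real))"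
      by (rule P.AE_integrable_fst'[OF int[of "\<lambda>_. 1" 1]]) auto
    then show "AE z in ?L2. (\<integral>t. indicator E (z, t) * g (T (z, t)) \<partial>lborel)
        = indicator (level_lines \<rho> h) z * (\<phi> (fst z + b z *\<^sub>R h) - \<phi> (fst z + a z *\<^sub>R h))"
    proof eventually_elim
      case (elim z)
      show ?case
      proof (cases "fst z \<in> slab h \<and> 0 < snd z")
        case False
        then show ?thesis by (auto simp: E_def level_lines_def)
      next
        case True
        let ?I = "level_section \<rho> h z"
        have ind: "indicator E (z, t) = (indicator ?I t :: real)" for t
          using True by (simp add: E_def level_section_def indicator_def)
        have Im: "?I \<in> sets borel" unfolding level_section_def by measurable
        have "emeasure lborel ?I < \<infinity>"
          using elim Im by (simp add: ind integrable_indicator_iff)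
        moreover have "convex ?I" by (rule convex_level_section[OF \<rho>])
        moreover have "DERIV (\<lambda>t. \<phi> (fst z + t *\<^sub>R h)) t :> g (fst z + t *\<^sub>R h)" for t
        proof -
          have "(\<phi> has_derivative frechet_derivative \<phi> (at (fst z + t *\<^sub>R h))) (at (fst z + t *\<^sub>R h))"
            using \<phi> frechet_derivative_works by blast
          moreover have "((\<lambda>t. fst z + t *\<^sub>R h) has_derivative (\<lambda>s. s *\<^sub>R h)) (at t)"
            by (auto intro!: derivative_eq_intros)
          ultimately have "((\<lambda>t. \<phi> (fst z + t *\<^sub>R h)) has_derivative
              (\<lambda>s. frechet_derivative \<phi> (at (fst z + t *\<^sub>R h)) (s *\<^sub>R h))) (at t)"
            by (rule has_derivative_compose[rotated])
          moreover have "frechet_derivative \<phi> (at (fst z + t *\<^sub>R h)) (s *\<^sub>R h) = g (fst z + t *\<^sub>R h) * s" for s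
            using linear_frechet_derivative[OF \<phi>] by (simp add: linear_cmul g mult.commute)
          ultimately show ?thesis by (simp add: has_field_derivative_def)
        qed
        moreover have "isCont (\<lambda>t. g (fst z + t *\<^sub>R h)) t" for t
          using gc by (intro isCont_o2[of t _ g]) (auto simp: continuous_on_eq_continuous_at)
        ultimately have "(\<integral>t. indicator ?I t * g (fst z + t *\<^sub>R h) \<partial>lborel) =
          (if \<bar>rat_inf ?I\<bar> \<noteq> \<infinity> \<and> \<bar>rat_sup ?I\<bar> \<noteq> \<infinity>
           then \<phi> (fst z + b z *\<^sub>R h) - \<phi> (fst z + a z *\<^sub>R h) else 0)"
          unfolding a_def b_def using Im by (intro integral_indicator_convex_FTC) auto
        then show ?thesis using True by (simp add: ind T_def level_lines_def)
      qed
    qed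
  qed
  finally show ?thesis .
qed


section \<open>The Skorohod derivative and its total variation\<close>

theorem theorem3p1:
  "\<exists>C::real. \<forall>(\<mu>::'a::euclidean_space measure) (\<rho>::'a \<Rightarrow> real) (h::'a).
     \<rho> \<in> borel_measurable borel \<longrightarrow> log_concave_density \<rho> \<longrightarrow>
     \<mu> = density lborel (\<lambda>x. ennreal (\<rho> x)) \<longrightarrow>
     isotropic_with_constant \<mu> 1 \<longrightarrow> norm h = 1 \<longrightarrow>
     (\<exists>\<nu>. skorohod_derivative \<mu> h \<nu> \<and> tv_norm \<nu> \<le> C)"
proof (intro exI[of _ "2 * 2 ^ (DIM('a) + 6) * 2 ^ DIM('a)"] allI impI)
  fix \<mu> :: "'a measure" and \<rho> :: "'a \<Rightarrow> real" and h :: 'a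
  assume m[measurable]: "\<rho> \<in> borel_measurable borel" and \<rho>: "log_concave_density \<rho>"
    and \<mu>: "\<mu> = density lborel (\<lambda>x. ennreal (\<rho> x))"
    and iso: "isotropic_with_constant \<mu> 1" and h: "norm h = 1"
  let ?D = "level_lines \<rho> h" and ?L2 = "lborel \<Otimes>\<^sub>M lborel :: ('a \<times> real) measure"
  \<comment> \<open>This bounds the mass of each of the two endpoint measures, whence the factor 2
    in the final constant. The first power comes from the line bound, the second from the halving
    substitution.\<close>
  let ?c = "2 ^ (DIM('a) + 6) * 2 ^ DIM('a) :: real"
  interpret prob_space \<mu> using iso by (simp add: isotropic_with_constant_def)
  have int1: "(\<integral>\<^sup>+x. ennreal (\<rho> x) \<partial>lborel) = 1"
    using emeasure_space_1 by (simp add: \<mu> emeasure_density)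
  obtain p where p: "\<And>x q. ennreal (\<rho> (x + q *\<^sub>R h)) \<le>
      ennreal (2 ^ (DIM('a) + 6)) * (\<integral>\<^sup>+t. ennreal (\<rho> ((1/2) *\<^sub>R p + (1/2) *\<^sub>R (x + t *\<^sub>R h))) \<partial>lborel)"
    using isotropic_log_concave_line_bound[OF \<rho> m iso[unfolded \<mu>] h] by blast
  have "emeasure ?L2 ?D
      \<le> (\<integral>\<^sup>+x. ennreal (2 ^ (DIM('a) + 6)) * ennreal (\<rho> ((1/2) *\<^sub>R p + (1/2) *\<^sub>R x)) \<partial>lborel)"
    by (rule emeasure_level_lines_le[OF h m]) (use p in \<open>auto simp: nn_integral_cmult\<close>)
  also have "\<dots> = ennreal (2 ^ (DIM('a) + 6)) * 2 ^ DIM('a)"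
    using nn_integral_half[of "\<lambda>x. ennreal (\<rho> x)" p] by (simp add: nn_integral_cmult int1)
  also have "\<dots> = ennreal ?c"
    by (simp add: ennreal_mult ennreal_power[symmetric])
  finally have D: "emeasure ?L2 ?D \<le> ennreal ?c" .

  \<comment> \<open>The selector \<open>e\<close> is \<open>rat_inf\<close> or
    \<open>rat_sup\<close>, so both endpoint measures are treated at once. The restriction to
    \<open>level_lines\<close> discards infinite endpoints, for which \<open>real_of_ereal\<close>
    only returns a default value.\<close>
  define N where "N = (\<lambda>e. distr (density ?L2 (\<lambda>z. ennreal (indicator ?D z))) borel
    (\<lambda>z. fst z + real_of_ereal (e (level_section \<rho> h z)) *\<^sub>R h))"
  have N: "finite_measure (N e)" "sets (N e) = sets borel" "measure (N e) UNIV \<le> ?c"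
    "\<And>\<phi>::'a \<Rightarrow> real. \<phi> \<in> borel_measurable borel \<Longrightarrow> bounded (range \<phi>) \<Longrightarrow>
      integrable ?L2 (\<lambda>z. indicator ?D z * \<phi> (fst z + real_of_ereal (e (level_section \<rho> h z)) *\<^sub>R h)) \<and>
      (\<integral>x. \<phi> x \<partial>N e) = (\<integral>z. indicator ?D z * \<phi> (fst z + real_of_ereal (e (level_section \<rho> h z)) *\<^sub>R h) \<partial>?L2)"
    if [measurable]: "(\<lambda>z. e (level_section \<rho> h z)) \<in> borel_measurable ?L2" for e
  proof -
    show s: "sets (N e) = sets borel" by (simp add: N_def)
    then have sp: "space (N e) = UNIV" using sets_eq_imp_space_eq[OF s] by simp
    have "emeasure (N e) UNIV = emeasure (density ?L2 (\<lambda>z. ennreal (indicator ?D z))) (space ?L2)"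
      unfolding N_def by (subst emeasure_distr) simp_all
    also have "\<dots> = emeasure ?L2 ?D"
    proof -
      have "emeasure (density ?L2 (\<lambda>z. ennreal (indicator ?D z))) (space ?L2)
          = (\<integral>\<^sup>+z. ennreal (indicator ?D z) * indicator (space ?L2) z \<partial>?L2)"
        by (rule emeasure_density[OF _ sets.top]) measurable
      also have "\<dots> = (\<integral>\<^sup>+z. indicator ?D z \<partial>?L2)"
        by (rule nn_integral_cong) (auto split: split_indicator)
      also have "\<dots> = emeasure ?L2 ?D" by (rule nn_integral_indicator) measurable
      finally show ?thesis .
    qed
    finally have e: "emeasure (N e) UNIV \<le> ennreal ?c" using D by simp
    show fin: "finite_measure (N e)" using e by (intro finite_measureI) (auto simp: sp top_unique)
    show "measure (N e) UNIV \<le> ?c"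
      using e finite_measure.emeasure_eq_measure[OF fin, of UNIV] by simp
    fix \<phi> :: "'a \<Rightarrow> real" assume [measurable]: "\<phi> \<in> borel_measurable borel" and "bounded (range \<phi>)"
    then obtain B where B: "\<And>x. \<bar>\<phi> x\<bar> \<le> B" by (auto simp: bounded_iff)
    have "integrable (N e) \<phi>"
      by (rule finite_measure.integrable_const_bound[OF fin, of _ B])
        (use B in \<open>auto simp: measurable_cong_sets[OF s refl]\<close>)
    then have "integrable (density ?L2 (\<lambda>z. ennreal (indicator ?D z)))
        (\<lambda>z. \<phi> (fst z + real_of_ereal (e (level_section \<rho> h z)) *\<^sub>R h))"
      unfolding N_def by (subst (asm) integrable_distr_eq) auto
    moreover have "(\<integral>x. \<phi> x \<partial>N e) =
        (\<integral>z. indicator ?D z * \<phi> (fst z + real_of_ereal (e (level_section \<rho> h z)) *\<^sub>R h) \<partial>?L2)"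
      unfolding N_def by (subst integral_distr) (auto simp: integral_density)
    ultimately show "integrable ?L2 (\<lambda>z. indicator ?D z * \<phi> (fst z + real_of_ereal (e (level_section \<rho> h z)) *\<^sub>R h)) \<and>
      (\<integral>x. \<phi> x \<partial>N e) = (\<integral>z. indicator ?D z * \<phi> (fst z + real_of_ereal (e (level_section \<rho> h z)) *\<^sub>R h) \<partial>?L2)"
      by (subst (asm) integrable_density) auto
  qed
  note Ni = N[OF measurable_level_section(1)[OF m]] and Ns = N[OF measurable_level_section(2)[OF m]]
  \<comment> \<open>The derivative of the indicator of an interval has mass +1 at the left and -1 at
    the right endpoint. The minus sign in \<open>skorohod_derivative\<close> then restores right
    value minus left value.\<close>
  let ?\<nu> = "\<lambda>A. measure (N rat_inf) A - measure (N rat_sup) A"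
  note diff = signed_borel_measure_diff[OF Ni(1) Ns(1) Ni(2) Ns(2)]
    tv_norm_diff_le[OF Ni(1) Ns(1) Ni(2) Ns(2)] signed_integral_diff[OF Ni(1) Ns(1) Ni(2) Ns(2)]
  have "(\<integral>x. frechet_derivative \<phi> (at x) h \<partial>\<mu>) = - signed_integral ?\<nu> \<phi>" if \<phi>: "\<phi> \<in> Cb_inf" for \<phi>
  proof -
    have d: "iter_dderiv \<phi> vs differentiable (at x)" "bounded (range (iter_dderiv \<phi> vs))" for vs x
      using \<phi> by (auto simp: Cb_inf_def)
    have d0: "\<phi> differentiable (at x)" "bounded (range \<phi>)" for x
      using d[of "[]"] by auto
    define g where "g = (\<lambda>x. frechet_derivative \<phi> (at x) h)"
    \<comment> \<open>Applying the condition of \<open>Cb_inf\<close> to the list \<open>[h]\<close>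
      makes \<open>g\<close> itself differentiable and bounded; its continuity follows.\<close>
    have dg: "g differentiable (at x)" "bounded (range g)" for x
      using d[of "[h]"] by (auto simp: g_def)
    have gc: "continuous_on UNIV g"
      by (intro continuous_at_imp_continuous_on ballI differentiable_imp_continuous_within dg)
    have \<phi>m: "\<phi> \<in> borel_measurable borel"
      by (intro borel_measurable_continuous_onI continuous_at_imp_continuous_on ballI
        differentiable_imp_continuous_within d0)
    obtain B where B: "\<And>x. \<bar>g x\<bar> \<le> B" using dg(2) by (auto simp: bounded_iff)
    note i = Ni(4)[OF \<phi>m d0(2)] and s = Ns(4)[OF \<phi>m d0(2)]
    have "(\<integral>x. g x \<partial>\<mu>) = (\<integral>x. \<phi> x \<partial>N rat_sup) - (\<integral>x. \<phi> x \<partial>N rat_inf)"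
      unfolding \<mu> integral_directional_derivative[OF \<rho> m int1 h d0(1) fun_cong[OF g_def] gc B]
      using i s by (simp add: right_diff_distrib)
    then show ?thesis by (simp add: g_def diff(3)[OF \<phi>m d0(2)])
  qed
  then have "skorohod_derivative \<mu> h ?\<nu>" using diff(1) by (simp add: skorohod_derivative_def)
  moreover have "tv_norm ?\<nu> \<le> 2 * 2 ^ (DIM('a) + 6) * 2 ^ DIM('a)"
    using diff(2) Ni(3) Ns(3) by linarith
  ultimately show "\<exists>\<nu>. skorohod_derivative \<mu> h \<nu> \<and> tv_norm \<nu> \<le> 2 * 2 ^ (DIM('a) + 6) * 2 ^ DIM('a)"
    by blast
qed

end
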